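(* Let $U$ be a solution of either the $hp$-cG scheme or the $hp$-dG scheme (both defined in the context) for the initial value problem $u'(t)=\mathcal F(t,u(t))$, $u(0)=u_0$, on $(0,T)$, and let $e=u-U$ be the error, where $u$ is the exact solution. For any $m\ge 1$ (with $m\le M$), if $\delta_1,\dots,\delta_m$ exist, then $$\|e\|_{L^\infty(I_m;H)}\le \delta_m\,\psi_m+\|U-\widehat U_m\|_{L^\infty(I_m;H)} .$$
   Context: Setting. $H$ is a real Hilbert space with inner product $(\cdot,\cdot)_H$ and norm $\|\cdot\|_H$; $T>0$, $u_0\in H$. The map $\mathcal F:[0,T]\times H\to H$ satisfies: $\mathcal F(\cdot,v)$ is strongly measurable for each $v\in H$, $\mathcal F(\cdot,0)\in L^1((0,T);H)$, and $$\|\mathcal F(t,v)-\mathcal F(t,w)\|_H\le \mathcal L(t,\|v\|_H,\|w\|_H)\,\|v-w\|_H\qquad\forall t\in[0,T],\ \forall v,w\in H,$$ where $\mathcal L:[0,T]\times\mathbb R_0^+\times\mathbb R_0^+\to\mathbb R_0^+$ is a known function with $\mathcal L(\cdot,a,b)\in L^1((0,T))$ for all $a,b\ge0$, continuous and monotone increasing in its second and third arguments. $u\in C([0,T];H)$ denotes the unique solution, i.e. $u(t)=u_0+\int_0^t\mathcal F(s,u(s))\,ds$ for $t\in[0,T]$. Discretization. $0=t_0<t_1<\dots<t_M=T$, $I_m=(t_{m-1},t_m)$, $k_m=t_m-t_{m-1}$. To each $I_m$ are associated a polynomial degree $r_m\in\mathbb N_0$ ($r_m\ge1$ for the cG scheme)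 and a finite-dimensional subspace $H_m\subset H$; $\pi_m:H\to H_m$ is the $H$-orthogonal projection. $\mathcal P^r(I_m;H_m)$ is the space of polynomials in $t$ of degree at most $r$ on $I_m$ with coefficients in $H_m$, and $\Pi_m^{r}$ is the $L^2$-projection onto it: $\Pi_m^r f\in\mathcal P^r(I_m;H_m)$ and $\int_{I_m}(\Pi^r_mf-f,V)_H\,dt=0$ for all $V\in\mathcal P^r(I_m;H_m)$. One-sided limits at nodes are written $U(t_m^\pm)$, with the convention $U(t_0^-):=u_0$. $hp$-cG scheme: for $m=1,\dots,M$, $U|_{I_m}\in\mathcal P^{r_m}(I_m;H_m)$ satisfies $\int_{I_m}(U',V)_H\,dt=\int_{I_m}(\mathcal F(t,U),V)_H\,dt$ for all $V\in\mathcal P^{r_m-1}(I_m;H_m)$, and $U(t_{m-1}^+)=\pi_mU(t_{m-1}^-)$. $hp$-dG scheme: for $m=1,\dots,M$, $U|_{I_m}\in\mathcal P^{r_m}(I_m;H_m)$ satisfies $\int_{I_m}(U',V)_H\,dt+(U(t_{m-1}^+)-U(t_{m-1}^-),V(t_{m-1}^+))_H=\int_{I_m}(\mathcal F(t,U),V)_H\,dt$ for all $V\in\mathcal P^{r_m}(I_m;H_m)$. Reconstruction, estimators. For $t\in\bar I_m$: $\widehat U_m(t):=\pi_mU(t_{m-1}^-)+\int_{t_{m-1}}^t\Pi_m^{r_m}\mathcal F(s,U)\,ds$ and $\widehat e_m(t):=u(t)-\widehat U_m(t)$. The residual on $I_m$ is $\mathcal R(t):=\widehat U_m(t_{m-1})-\widehat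 U_m(t)+\int_{t_{m-1}}^t\mathcal F(s,\widehat U_m)\,ds$, and $\eta_m^{\mathrm{res}}:=\|\mathcal R\|_{L^\infty(I_m;H)}$. For $m\ge0$, $\eta_m^{\mathrm{proj}}:=\|U(t_m^-)-\pi_{m+1}U(t_m^-)\|_H$. The numbers $\psi_m$ are any chosen real numbers with $$\psi_1\ge\eta_0^{\mathrm{proj}}+\eta_1^{\mathrm{res}},\qquad \psi_m\ge\|\widehat e_{m-1}(t_{m-1})\|_H+\eta_{m-1}^{\mathrm{proj}}+\eta_m^{\mathrm{res}}\quad(m\ge2).$$ The numbers $\delta_m$. Define $\varphi_m:[1,\infty)\to\mathbb R$ by $$\varphi_m(\delta):=\exp\Big(\int_{I_m}\mathcal L\big(s,\delta\psi_m+\|\widehat U_m(s)\|_H,\|\widehat U_m(s)\|_H\big)\,ds\Big)-\delta,$$ and $\delta_m:=\inf\{\delta>1:\varphi_m(\delta)<0\}\in[1,\infty)$; "$\delta_m$ exists" means that this set is non-empty. *)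

theory Defs
  imports "HOL-Analysis.Analysis" "HOL-Probability.Essential_Supremum"
begin

text \<open>The library's Bochner integral is restricted to second countable spaces. The Hilbert space
  here need not be separable, so strong measurability and the Bochner integral are introduced for
  arbitrary normed spaces, on top of the library's integral of simple functions. The library's
  integral is used for all scalar integrands.\<close>

definition strongly_measurable :: "'b measure \<Rightarrow> ('b \<Rightarrow> 'a::real_normed_vector) \<Rightarrow> bool" where
  "strongly_measurable M f \<longleftrightarrow>
     (\<exists>g. (\<forall>i::nat. simple_function M (g i)) \<and> (AE x in M. (\<lambda>i. g i x) \<longlonglongrightarrow> f x))"

definition has_Bochner_integral ::
    "'b measure \<Rightarrow> ('b \<Rightarrow> 'a::real_normed_vector) \<Rightarrow> 'a \<Rightarrow> bool" where
  "has_Bochner_integral M f x \<longleftrightarrow>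
     strongly_measurable M f \<and>
     (\<exists>g. (\<forall>i::nat. Bochner_Integration.simple_bochner_integrable M (g i)) \<and>
        (\<lambda>i. \<integral>\<^sup>+ y. ennreal (norm (f y - g i y)) \<partial>M) \<longlonglongrightarrow> 0 \<and>
        (\<lambda>i. Bochner_Integration.simple_bochner_integral M (g i)) \<longlonglongrightarrow> x)"

definition Bochner_integrable :: "'b measure \<Rightarrow> ('b \<Rightarrow> 'a::real_normed_vector) \<Rightarrow> bool" where
  "Bochner_integrable M f \<longleftrightarrow> (\<exists>x. has_Bochner_integral M f x)"

definition Bochner_integral :: "'b measure \<Rightarrow> ('b \<Rightarrow> 'a::real_normed_vector) \<Rightarrow> 'a" where
  "Bochner_integral M f =
     (if Bochner_integrable M f then THE x. has_Bochner_integral M f x else 0)"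

definition Linf_norm :: "real set \<Rightarrow> (real \<Rightarrow> 'a::real_normed_vector) \<Rightarrow> ereal" where
  "Linf_norm I f = esssup (lebesgue_on I) (\<lambda>s. ereal (norm (f s)))"

definition orth_proj :: "'a::real_inner set \<Rightarrow> 'a \<Rightarrow> 'a" where
  "orth_proj S x = (THE y. y \<in> S \<and> (\<forall>v\<in>S. inner (x - y) v = 0))"

text \<open>A polynomial on an interval of positive length is identified with its unique polynomial
  extension to the real line, so the interval is not a parameter of the polynomial space, and
  one-sided limits of polynomials are ordinary values.\<close>

definition poly_space :: "nat \<Rightarrow> 'a::real_vector set \<Rightarrow> (real \<Rightarrow> 'a) set" where
  "poly_space r S = {p. \<exists>c. (\<forall>i\<le>r. c i \<in> S) \<and> p = (\<lambda>s. \<Sum>i\<le>r. s ^ i *\<^sub>R c i)}"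

definition L2_proj :: "real set \<Rightarrow> nat \<Rightarrow> 'a::real_inner set \<Rightarrow> (real \<Rightarrow> 'a) \<Rightarrow> real \<Rightarrow> 'a" where
  "L2_proj I r S f =
     (THE p. p \<in> poly_space r S \<and>
        (\<forall>V\<in>poly_space r S. (LINT s|lebesgue_on I. inner (p s - f s) (V s)) = 0))"

text \<open>In the following, \<open>t\<close> is the sequence of time nodes, \<open>r m\<close> and \<open>Hs m\<close> are the polynomial
  degree and the discrete subspace on the \<open>m\<close>-th interval (\<open>1 \<le> m \<le> M\<close>). Values of \<open>U\<close> at the
  nodes are never used.\<close>

definition cell :: "(nat \<Rightarrow> real) \<Rightarrow> nat \<Rightarrow> real set" where
  "cell t m = {t (m - 1)<..<t m}"

definition left_value :: "'a::real_inner \<Rightarrow> (nat \<Rightarrow> real) \<Rightarrow> (real \<Rightarrow> 'a) \<Rightarrow> nat \<Rightarrow> 'a" where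
  "left_value u0 t U m = (if m = 0 then u0 else Lim (at_left (t m)) U)"

definition right_value :: "(nat \<Rightarrow> real) \<Rightarrow> (real \<Rightarrow> 'a::real_inner) \<Rightarrow> nat \<Rightarrow> 'a" where
  "right_value t U m = Lim (at_right (t m)) U"

definition piecewise_poly ::
    "nat \<Rightarrow> (nat \<Rightarrow> real) \<Rightarrow> (nat \<Rightarrow> nat) \<Rightarrow> (nat \<Rightarrow> 'a::real_vector set) \<Rightarrow> (real \<Rightarrow> 'a) \<Rightarrow> bool" where
  "piecewise_poly M t r Hs U \<longleftrightarrow>
     (\<forall>m\<in>{1..M}. \<exists>p\<in>poly_space (r m) (Hs m). \<forall>s\<in>cell t m. U s = p s)"

definition hp_cG ::
    "(real \<Rightarrow> 'a::real_inner \<Rightarrow> 'a) \<Rightarrow> 'a \<Rightarrow> nat \<Rightarrow> (nat \<Rightarrow> real) \<Rightarrow> (nat \<Rightarrow> nat) \<Rightarrow> (nat \<Rightarrow> 'a set)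
       \<Rightarrow> (real \<Rightarrow> 'a) \<Rightarrow> bool" where
  "hp_cG F u0 M t r Hs U \<longleftrightarrow>
     piecewise_poly M t r Hs U \<and>
     (\<forall>m\<in>{1..M}.
        1 \<le> r m \<and>
        (\<forall>V\<in>poly_space (r m - 1) (Hs m).
           (LINT s|lebesgue_on (cell t m). inner (vector_derivative U (at s)) (V s)) =
           (LINT s|lebesgue_on (cell t m). inner (F s (U s)) (V s))) \<and>
        right_value t U (m - 1) = orth_proj (Hs m) (left_value u0 t U (m - 1)))"

definition hp_dG ::
    "(real \<Rightarrow> 'a::real_inner \<Rightarrow> 'a) \<Rightarrow> 'a \<Rightarrow> nat \<Rightarrow> (nat \<Rightarrow> real) \<Rightarrow> (nat \<Rightarrow> nat) \<Rightarrow> (nat \<Rightarrow> 'a set)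
       \<Rightarrow> (real \<Rightarrow> 'a) \<Rightarrow> bool" where
  "hp_dG F u0 M t r Hs U \<longleftrightarrow>
     piecewise_poly M t r Hs U \<and>
     (\<forall>m\<in>{1..M}.
        \<forall>V\<in>poly_space (r m) (Hs m).
           (LINT s|lebesgue_on (cell t m). inner (vector_derivative U (at s)) (V s)) +
           inner (right_value t U (m - 1) - left_value u0 t U (m - 1)) (V (t (m - 1))) =
           (LINT s|lebesgue_on (cell t m). inner (F s (U s)) (V s)))"

definition Uhat ::
    "(real \<Rightarrow> 'a::real_inner \<Rightarrow> 'a) \<Rightarrow> 'a \<Rightarrow> (nat \<Rightarrow> real) \<Rightarrow> (nat \<Rightarrow> nat) \<Rightarrow> (nat \<Rightarrow> 'a set)
       \<Rightarrow> (real \<Rightarrow> 'a) \<Rightarrow> nat \<Rightarrow> real \<Rightarrow> 'a" where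
  "Uhat F u0 t r Hs U m s =
     orth_proj (Hs m) (left_value u0 t U (m - 1)) +
     Bochner_integral (lebesgue_on {t (m - 1)..s})
       (L2_proj (cell t m) (r m) (Hs m) (\<lambda>x. F x (U x)))"

definition residual ::
    "(real \<Rightarrow> 'a::real_inner \<Rightarrow> 'a) \<Rightarrow> 'a \<Rightarrow> (nat \<Rightarrow> real) \<Rightarrow> (nat \<Rightarrow> nat) \<Rightarrow> (nat \<Rightarrow> 'a set)
       \<Rightarrow> (real \<Rightarrow> 'a) \<Rightarrow> nat \<Rightarrow> real \<Rightarrow> 'a" where
  "residual F u0 t r Hs U m s =
     Uhat F u0 t r Hs U m (t (m - 1)) - Uhat F u0 t r Hs U m s +
     Bochner_integral (lebesgue_on {t (m - 1)..s}) (\<lambda>x. F x (Uhat F u0 t r Hs U m x))"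

definition eta_res ::
    "(real \<Rightarrow> 'a::real_inner \<Rightarrow> 'a) \<Rightarrow> 'a \<Rightarrow> (nat \<Rightarrow> real) \<Rightarrow> (nat \<Rightarrow> nat) \<Rightarrow> (nat \<Rightarrow> 'a set)
       \<Rightarrow> (real \<Rightarrow> 'a) \<Rightarrow> nat \<Rightarrow> ereal" where
  "eta_res F u0 t r Hs U m = Linf_norm (cell t m) (residual F u0 t r Hs U m)"

definition eta_proj ::
    "'a::real_inner \<Rightarrow> (nat \<Rightarrow> real) \<Rightarrow> (nat \<Rightarrow> 'a set) \<Rightarrow> (real \<Rightarrow> 'a) \<Rightarrow> nat \<Rightarrow> real" where
  "eta_proj u0 t Hs U m =
     norm (left_value u0 t U m - orth_proj (Hs (m + 1)) (left_value u0 t U m))"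

text \<open>In \<open>phi\<close>, \<open>delta_set\<close> and \<open>delta\<close>, the arguments \<open>I\<close>, \<open>\<psi>\<close>, \<open>W\<close> stand for the \<open>m\<close>-th
  interval, the number \<open>\<psi>\<^sub>m\<close> and the reconstruction on that interval. The infimum
  \<open>delta\<close> is meaningful when \<open>delta_set\<close> is nonempty (``\<open>\<delta>\<^sub>m\<close> exists'').\<close>

definition phi ::
    "(real \<Rightarrow> real \<Rightarrow> real \<Rightarrow> real) \<Rightarrow> real set \<Rightarrow> real \<Rightarrow> (real \<Rightarrow> 'a::real_normed_vector)
       \<Rightarrow> real \<Rightarrow> real" where
  "phi L I \<psi> W \<delta> =
     exp (LINT s|lebesgue_on I. L s (\<delta> * \<psi> + norm (W s)) (norm (W s))) - \<delta>"

definition delta_set ::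
    "(real \<Rightarrow> real \<Rightarrow> real \<Rightarrow> real) \<Rightarrow> real set \<Rightarrow> real \<Rightarrow> (real \<Rightarrow> 'a::real_normed_vector)
       \<Rightarrow> real set" where
  "delta_set L I \<psi> W = {\<delta>. 1 < \<delta> \<and> phi L I \<psi> W \<delta> < 0}"

definition delta ::
    "(real \<Rightarrow> real \<Rightarrow> real \<Rightarrow> real) \<Rightarrow> real set \<Rightarrow> real \<Rightarrow> (real \<Rightarrow> 'a::real_normed_vector)
       \<Rightarrow> real" where
  "delta L I \<psi> W = Inf (delta_set L I \<psi> W)"

end

theory Submission
  imports Defs
begin

text \<open>Testing either scheme with functions that are constant on \<open>I\<^sub>m\<close> shows that the reconstruction
  reaches the value \<open>U(t\<^sub>m\<^sup>-)\<close> at the right end point, so that \<open>\<psi>\<^sub>m\<close> bounds the initial error of the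
  reconstruction on \<open>I\<^sub>m\<close> plus its residual. The error therefore satisfies an integral inequality with
  constant \<open>\<psi>\<^sub>m\<close> and coefficient \<open>L(s, |u(s)|, |W(s)|)\<close>, where \<open>W\<close> is the reconstruction. For every
  \<open>\<delta> > 1\<close> with \<open>\<phi>\<^sub>m(\<delta>) < 0\<close> a continuity argument with Gronwall's inequality keeps the error below
  \<open>\<delta> \<psi>\<^sub>m\<close>; taking the infimum over \<open>\<delta>\<close> gives \<open>\<delta>\<^sub>m \<psi>\<^sub>m\<close>.\<close>

text \<open>The space need not be separable, and this shapes much of the proof. Strong measurability
  of \<open>\<lambda>s. F s (w s)\<close> comes from approximating the time variable, not the values
  of \<open>w\<close>, by simple functions. Identities and norm estimates for Bochner integrals are
  reduced to scalar integrals by testing with a vector; for a norm estimate the test vector is the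
  integral itself. The coefficient in the integral inequality is merely integrable, so Gronwall's
  inequality cannot rest on differentiating its right-hand side at every point. Since
  \<open>eta_res\<close> is an essential supremum, the error inequality holds at first only for
  almost every time. The error is continuous and the integral is monotone in its upper limit, and
  this yields every time. The number \<open>\<psi> m\<close> majorises the true error at the
  preceding node rather than an estimate of it, so each interval is treated on its own, without
  induction over the intervals. The infimum \<open>delta\<close> need not belong to
  \<open>delta_set\<close>, whose strict inequality drives the contradiction; hence the bound is
  proved for the members first.\<close>

section \<open>Strong measurability\<close>

text \<open>Strong measurability asks for convergence almost everywhere only. Passing from it to
  Borel measurability of norms and inner products requires a complete measure.\<close>

lemma complete_measure_lebesgue_on:
  fixes S :: "'a::euclidean_space set"
  assumes "S \<in> sets lebesgue"
  shows "complete_measure (lebesgue_on S)"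
proof
  fix A B assume "B \<subseteq> A" "A \<in> null_sets (lebesgue_on S)"
  then have "B \<subseteq> S" "A \<in> null_sets lebesgue"
    using assms by (auto simp: null_sets_restrict_space)
  then have "B \<in> null_sets lebesgue"
    using \<open>B \<subseteq> A\<close> by (blast intro: completion.complete2)
  then show "B \<in> sets (lebesgue_on S)"
    using assms \<open>B \<subseteq> S\<close> by (auto simp: sets_restrict_space_iff)
qed

text \<open>The function \<open>\<lambda>x. lim (\<lambda>i. g i x)\<close> is measurable whether or
  not the limits exist, and it agrees with \<open>f\<close> almost everywhere; completeness
  transfers the preimages.\<close>

lemma borel_measurable_AE_LIMSEQ:
  fixes f :: "'a \<Rightarrow> 'b::{banach, second_countable_topology}"
  assumes "complete_measure M" "\<And>i::nat. g i \<in> borel_measurable M"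
    and lim: "AE x in M. (\<lambda>i. g i x) \<longlonglongrightarrow> f x"
  shows "f \<in> borel_measurable M"
proof -
  interpret complete_measure M by fact
  have meas: "(\<lambda>x. lim (\<lambda>i. g i x)) \<in> borel_measurable M"
    using assms(2) by (rule borel_measurable_lim_metric)
  show ?thesis
  proof (rule measurableI)
    fix A :: "'b set" assume A: "A \<in> sets borel"
    show "f -` A \<inter> space M \<in> sets M"
    proof (rule in_sets_AE)
      show "(\<lambda>x. lim (\<lambda>i. g i x)) -` A \<inter> space M \<in> sets M"
        using meas A by (rule measurable_sets)
      show "AE x in M. x \<in> (\<lambda>x. lim (\<lambda>i. g i x)) -` A \<inter> space M \<longleftrightarrow> x \<in> f -` A \<inter> space M"
        using lim by eventually_elim (auto dest: limI)
    qed auto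
  qed auto
qed

lemma strongly_measurable_comp:
  assumes "strongly_measurable M f" "continuous_on UNIV h"
  shows "strongly_measurable M (\<lambda>x. h (f x))"
proof -
  from assms(1) obtain g where g: "\<And>i::nat. simple_function M (g i)"
    "AE x in M. (\<lambda>i. g i x) \<longlonglongrightarrow> f x"
    unfolding strongly_measurable_def by blast
  have "AE x in M. (\<lambda>i. h (g i x)) \<longlonglongrightarrow> h (f x)"
    using g(2) by eventually_elim (auto intro: continuous_on_tendsto_compose[OF assms(2)])
  then show ?thesis
    unfolding strongly_measurable_def using g(1)
    by (intro exI[of _ "\<lambda>i x. h (g i x)"]) (auto intro: simple_function_compose1)
qed

lemma strongly_measurable_diff:
  assumes "strongly_measurable M f" "strongly_measurable M g"
  shows "strongly_measurable M (\<lambda>x. f x - g x)"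
proof -
  from assms(1) obtain p where p: "\<And>i::nat. simple_function M (p i)"
    "AE x in M. (\<lambda>i. p i x) \<longlonglongrightarrow> f x"
    unfolding strongly_measurable_def by blast
  from assms(2) obtain q where q: "\<And>i::nat. simple_function M (q i)"
    "AE x in M. (\<lambda>i. q i x) \<longlonglongrightarrow> g x"
    unfolding strongly_measurable_def by blast
  have "AE x in M. (\<lambda>i. p i x - q i x) \<longlonglongrightarrow> f x - g x"
    using p(2) q(2) by eventually_elim (rule tendsto_diff)
  then show ?thesis
    unfolding strongly_measurable_def using p(1) q(1)
    by (intro exI[of _ "\<lambda>i x. p i x - q i x"]) (auto intro: simple_function_compose2)
qed

lemma simple_function_strongly_measurable:
  "simple_function M f \<Longrightarrow> strongly_measurable M f"
  unfolding strongly_measurable_def by (intro exI[of _ "\<lambda>i. f"]) auto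

lemma strongly_measurable_imp_borel_measurable:
  fixes f :: "'a \<Rightarrow> 'b::{banach, second_countable_topology}"
  assumes "complete_measure M" "strongly_measurable M f"
  shows "f \<in> borel_measurable M"
proof -
  from assms(2) obtain g where g: "\<And>i::nat. simple_function M (g i)"
    "AE x in M. (\<lambda>i. g i x) \<longlonglongrightarrow> f x"
    unfolding strongly_measurable_def by blast
  show ?thesis
    by (rule borel_measurable_AE_LIMSEQ[OF assms(1) borel_measurable_simple_function[OF g(1)] g(2)])
qed

lemma borel_measurable_imp_strongly_measurable:
  fixes f :: "'a \<Rightarrow> 'b::{real_normed_vector, second_countable_topology}"
  assumes "f \<in> borel_measurable M"
  shows "strongly_measurable M f"
proof -
  from borel_measurable_implies_sequence_metric[OF assms, of 0]
  obtain g where "\<forall>i. simple_function M (g i)" "\<forall>x\<in>space M. (\<lambda>i. g i x) \<longlonglongrightarrow> f x"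
    by blast
  then show ?thesis
    unfolding strongly_measurable_def by (intro exI[of _ g]) auto
qed

lemma borel_measurable_norm_strongly_measurable:
  assumes "complete_measure M" "strongly_measurable M f"
  shows "(\<lambda>x. norm (f x)) \<in> borel_measurable M"
  using assms(1)
  by (rule strongly_measurable_imp_borel_measurable)
    (rule strongly_measurable_comp[OF assms(2), of norm], intro continuous_intros)

lemma borel_measurable_inner_strongly_measurable:
  fixes f :: "'a \<Rightarrow> 'b::real_inner"
  assumes "complete_measure M" "strongly_measurable M f"
  shows "(\<lambda>x. inner (f x) v) \<in> borel_measurable M"
  using assms(1)
  by (rule strongly_measurable_imp_borel_measurable)
    (rule strongly_measurable_comp[OF assms(2), of "\<lambda>y. inner y v"], intro continuous_intros)

text \<open>On a finite measure space convergence almost everywhere implies convergence in measure: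
  the indicators of the exceptional sets tend to 0 and are dominated by 1.\<close>

lemma strongly_measurable_approx_in_measure:
  assumes "complete_measure M" "finite_measure M" "strongly_measurable M f" "0 < e"
  obtains g where "simple_function M g" "measure M {x\<in>space M. norm (f x - g x) > e} < e"
proof -
  interpret finite_measure M by fact
  from assms(3) obtain g where g: "\<And>i::nat. simple_function M (g i)"
    "AE x in M. (\<lambda>i. g i x) \<longlonglongrightarrow> f x"
    unfolding strongly_measurable_def by blast
  define A where "A i = {x\<in>space M. norm (f x - g i x) > e}" for i
  have [measurable]: "(\<lambda>x. norm (f x - g i x)) \<in> borel_measurable M" for i
    by (rule borel_measurable_norm_strongly_measurable[OF assms(1)
          strongly_measurable_diff[OF assms(3) simple_function_strongly_measurable[OF g(1)]]])
  have [measurable]: "A i \<in> sets M" for i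
    unfolding A_def by measurable
  have "(\<lambda>i. \<integral>x. indicat_real (A i) x \<partial>M) \<longlonglongrightarrow> (\<integral>x. 0 \<partial>M)"
  proof (rule integral_dominated_convergence[where w="\<lambda>_. 1"])
    show "AE x in M. (\<lambda>i. indicat_real (A i) x) \<longlonglongrightarrow> 0"
      using g(2)
    proof eventually_elim
      case (elim x)
      then have "(\<lambda>i. norm (f x - g i x)) \<longlonglongrightarrow> 0"
        by (intro tendsto_norm_zero) (auto intro!: tendsto_eq_intros)
      then have "eventually (\<lambda>i. norm (f x - g i x) < e) sequentially"
        by (rule order_tendstoD) fact
      then have "eventually (\<lambda>i. indicat_real (A i) x = 0) sequentially"
        by eventually_elim (auto simp: A_def)
      then show ?case
        by (rule tendsto_eventually)
    qed
  qed (auto simp: indicator_def)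
  then have "(\<lambda>i. measure M (A i)) \<longlonglongrightarrow> 0"
    by simp
  then have "eventually (\<lambda>i. measure M (A i) < e) sequentially"
    by (rule order_tendstoD) fact
  then obtain i where "measure M (A i) < e"
    by (auto simp: eventually_sequentially)
  with g(1) that show thesis
    unfolding A_def by blast
qed

text \<open>Without separability there is no Pettis-type criterion at hand; the diagonal sequence of simple
  functions is extracted with the Borel--Cantelli lemma.\<close>

lemma strongly_measurable_AE_LIMSEQ:
  assumes "complete_measure M" "finite_measure M"
    and "\<And>n::nat. strongly_measurable M (f n)"
    and lim: "AE x in M. (\<lambda>n. f n x) \<longlonglongrightarrow> h x"
  shows "strongly_measurable M h"
proof -
  interpret finite_measure M by fact
  \<comment> \<open>The tolerance \<open>(1/2)^n\<close> serves twice: it is summable, as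
    Borel--Cantelli requires of the exceptional sets, and it tends to 0, so that outside them
    \<open>g n\<close> has the same limit as \<open>f n\<close>.\<close>
  have "\<forall>n. \<exists>g. simple_function M g \<and>
      measure M {x\<in>space M. norm (f n x - g x) > (1/2)^n} < (1/2)^n"
  proof
    fix n
    have "0 < (1/2::real)^n"
      by simp
    from strongly_measurable_approx_in_measure[OF assms(1,2) assms(3)[of n] this]
    show "\<exists>g. simple_function M g \<and>
        measure M {x\<in>space M. norm (f n x - g x) > (1/2)^n} < (1/2)^n"
      by blast
  qed
  from choice[OF this] obtain g where g: "\<And>n. simple_function M (g n)"
    "\<And>n. measure M {x\<in>space M. norm (f n x - g n x) > (1/2)^n} < (1/2)^n"
    by blast
  define A where "A n = {x\<in>space M. norm (f n x - g n x) > (1/2)^n}" for n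
  have [measurable]: "(\<lambda>x. norm (f i x - g i x)) \<in> borel_measurable M" for i
    by (rule borel_measurable_norm_strongly_measurable[OF assms(1)
          strongly_measurable_diff[OF assms(3) simple_function_strongly_measurable[OF g(1)]]])
  have A: "A i \<in> sets M" for i
    unfolding A_def by measurable
  have "AE x in M. eventually (\<lambda>n. x \<in> space M - A n) sequentially"
  proof (rule borel_cantelli_AE1[OF A])
    show "summable (\<lambda>n. measure M (A n))"
    proof (rule summable_comparison_test'[of "\<lambda>n. (1/2)^n" 0])
      show "norm (measure M (A n)) \<le> (1/2)^n" for n
        using g(2)[of n] by (simp add: A_def)
    qed (simp add: summable_geometric)
    show "emeasure M (A n) < \<infinity>" for n
      by (simp add: less_top[symmetric])
  qed
  then have "AE x in M. (\<lambda>n. g n x) \<longlonglongrightarrow> h x"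
    using lim
  proof eventually_elim
    case (elim x)
    from elim(1) have "eventually (\<lambda>n. norm (f n x - g n x) \<le> (1/2)^n) sequentially"
      by eventually_elim (auto simp: A_def)
    then have "(\<lambda>n. f n x - g n x) \<longlonglongrightarrow> 0"
      by (rule Lim_null_comparison) (auto intro: LIMSEQ_realpow_zero)
    from tendsto_diff[OF elim(2) this] show ?case
      by simp
  qed
  with g(1) show ?thesis
    unfolding strongly_measurable_def by blast
qed

text \<open>Each value \<open>v\<close> has its own null set where its approximation fails. A simple
  \<open>q\<close> takes finitely many values, so these null sets can be united and the
  approximations glued along the level sets of \<open>q\<close>.\<close>

lemma strongly_measurable_simple_superposition:
  fixes G :: "'b \<Rightarrow> 'c \<Rightarrow> 'd::real_normed_vector"
  assumes G: "\<And>v. strongly_measurable M (\<lambda>x. G x v)" and q: "simple_function M q"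
  shows "strongly_measurable M (\<lambda>x. G x (q x))"
proof -
  from G obtain g where g: "\<And>v i. simple_function M (g v i)"
    "\<And>v. AE x in M. (\<lambda>i::nat. g v i x) \<longlonglongrightarrow> G x v"
    unfolding strongly_measurable_def by metis
  have fin: "finite (q ` space M)"
    using q by (rule simple_functionD)
  have "simple_function M (\<lambda>x. g (q x) i x)" for i
  proof -
    have "finite ((\<lambda>x. g (q x) i x) ` space M)"
    proof (rule finite_subset)
      show "finite (\<Union>v\<in>q ` space M. g v i ` space M)"
        using fin simple_functionD(1)[OF g(1)] by (rule finite_UN_I)
    qed auto
    moreover have "(\<lambda>x. g (q x) i x) -` {y} \<inter> space M \<in> sets M" for y
    proof -
      have "(\<lambda>x. g (q x) i x) -` {y} \<inter> space M =
          (\<Union>v\<in>q ` space M. (q -` {v} \<inter> space M) \<inter> (g v i -` {y} \<inter> space M))"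
        by auto
      also have "\<dots> \<in> sets M"
        using fin by (rule sets.finite_UN)
          (intro sets.Int simple_functionD(2)[OF q] simple_functionD(2)[OF g(1)])
      finally show ?thesis .
    qed
    ultimately show ?thesis
      unfolding simple_function_def by blast
  qed
  moreover have "AE x in M. (\<lambda>i. g (q x) i x) \<longlonglongrightarrow> G x (q x)"
  proof -
    have "AE x in M. \<forall>v\<in>q ` space M. (\<lambda>i. g v i x) \<longlonglongrightarrow> G x v"
      using fin g(2) by (subst AE_finite_all) auto
    then show ?thesis
      using AE_space by eventually_elim auto
  qed
  ultimately show ?thesis
    unfolding strongly_measurable_def by (intro exI[of _ "\<lambda>i x. g (q x) i x"] conjI allI)
qed

text \<open>A Caratheodory argument. With simple functions tending to the identity of
  \<open>{a..b}\<close>, the composites with \<open>w\<close> are simple whatever the target space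
  is, and continuity of \<open>w\<close> and of \<open>G s\<close> carries the limit
  through.\<close>

lemma strongly_measurable_superposition:
  fixes G :: "real \<Rightarrow> 'c::metric_space \<Rightarrow> 'd::real_normed_vector"
  assumes G: "\<And>v. strongly_measurable (lebesgue_on {a..b}) (\<lambda>s. G s v)"
    and cont: "\<And>s. s \<in> {a..b} \<Longrightarrow> continuous_on UNIV (G s)"
    and w: "continuous_on {a..b} w"
  shows "strongly_measurable (lebesgue_on {a..b}) (\<lambda>s. G s (w s))"
proof (cases "a \<le> b")
  case True
  let ?M = "lebesgue_on {a..b}"
  have "(\<lambda>s::real. s) \<in> borel_measurable ?M"
    by (intro measurable_restrict_space1 measurable_completion) simp
  from borel_measurable_implies_sequence_metric[OF this, of 0]
  obtain q where q: "\<And>i::nat. simple_function ?M (q i)"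
    "\<And>s. s \<in> {a..b} \<Longrightarrow> (\<lambda>i. q i s) \<longlonglongrightarrow> s"
    by (auto simp del: atLeastAtMost_iff)
  \<comment> \<open>The approximations of \<open>s\<close> may leave \<open>{a..b}\<close>, where
    nothing is known about \<open>w\<close>; clamping brings them back and fixes the points of the
    interval.\<close>
  define c where "c s = max a (min b s)" for s
  show ?thesis
  proof (rule strongly_measurable_AE_LIMSEQ)
    show "strongly_measurable ?M (\<lambda>s. G s (w (c (q i s))))" for i
      by (rule strongly_measurable_simple_superposition[OF G])
        (rule simple_function_compose1[OF q(1)])
    show "AE s in ?M. (\<lambda>i. G s (w (c (q i s)))) \<longlonglongrightarrow> G s (w s)"
    proof (rule AE_I2)
      fix s assume "s \<in> space ?M"
      then have s: "s \<in> {a..b}" by simp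
      then have "c s = s" by (simp add: c_def)
      have "(\<lambda>i. c (q i s)) \<longlonglongrightarrow> c s"
        unfolding c_def by (intro tendsto_intros q s)
      moreover have "c x \<in> {a..b}" for x
        using True by (auto simp: c_def)
      ultimately have "(\<lambda>i. w (c (q i s))) \<longlonglongrightarrow> w (c s)"
        by (intro continuous_on_tendsto_compose[OF w]) auto
      then show "(\<lambda>i. G s (w (c (q i s)))) \<longlonglongrightarrow> G s (w s)"
        unfolding \<open>c s = s\<close> by (intro continuous_on_tendsto_compose[OF cont[OF s]]) auto
    qed
  qed (auto intro!: complete_measure_lebesgue_on finite_measure_lebesgue_on)
next
  case False
  then show ?thesis
    unfolding strongly_measurable_def by (intro exI[of _ "\<lambda>i x. 0"]) auto
qed

lemma strongly_measurable_restrict: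
  fixes a b c d :: real
  assumes "strongly_measurable (lebesgue_on {a..b}) f" "{c..d} \<subseteq> {a..b}"
  shows "strongly_measurable (lebesgue_on {c..d}) f"
proof -
  let ?M = "lebesgue_on {a..b}" and ?N = "lebesgue_on {c..d}"
  from assms(1) obtain g where g: "\<And>i::nat. simple_function ?M (g i)"
    "AE x in ?M. (\<lambda>i. g i x) \<longlonglongrightarrow> f x"
    unfolding strongly_measurable_def by blast
  have "simple_function ?N (g i)" for i
  proof (rule simple_function_comp[OF _ g(1)])
    show "(\<lambda>x. x) \<in> measurable ?N ?M"
      using assms(2) by (auto intro!: measurable_restrict_space3)
  qed
  moreover have "AE x in ?N. (\<lambda>i. g i x) \<longlonglongrightarrow> f x"
  proof -
    have "AE x in lebesgue. x \<in> {a..b} \<longrightarrow> (\<lambda>i. g i x) \<longlonglongrightarrow> f x"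
      using g(2) by (subst (asm) AE_restrict_space_iff) auto
    then have "AE x in lebesgue. x \<in> {c..d} \<longrightarrow> (\<lambda>i. g i x) \<longlonglongrightarrow> f x"
      by eventually_elim (use assms(2) in auto)
    then show ?thesis
      by (subst AE_restrict_space_iff) auto
  qed
  ultimately show ?thesis
    unfolding strongly_measurable_def by blast
qed

section \<open>The Bochner integral\<close>

text \<open>Simple functions that converge almost everywhere need neither be integrable nor converge
  in mean. Truncating them against \<open>norm (f x)\<close> supplies a dominating function, and
  completeness of the space gives the limit of the integrals.\<close>

lemma has_Bochner_integral_exists:
  fixes f :: "'b \<Rightarrow> 'a::{real_normed_vector, complete_space}"
  assumes "complete_measure M"
    and f: "strongly_measurable M f" and fin: "(\<integral>\<^sup>+x. ennreal (norm (f x)) \<partial>M) < \<infinity>"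
  obtains x where "has_Bochner_integral M f x"
proof -
  from f obtain g where g: "\<And>i::nat. simple_function M (g i)"
    "AE x in M. (\<lambda>i. g i x) \<longlonglongrightarrow> f x"
    unfolding strongly_measurable_def by blast
  \<comment> \<open>Any factor above 1 would do: where \<open>f x\<close> is nonzero the cut is
    eventually inactive, and where \<open>f x = 0\<close> the function \<open>h\<close> vanishes.
    The distance to \<open>f\<close> is then at most \<open>3 * norm (f x)\<close>.\<close>
  define h where "h i x = (if norm (g i x) \<le> 2 * norm (f x) then g i x else 0)" for i x
  have [measurable]: "(\<lambda>x. norm (f x)) \<in> borel_measurable M"
    by (rule borel_measurable_norm_strongly_measurable[OF assms(1) f])
  have [measurable]: "(\<lambda>x. norm (g i x)) \<in> borel_measurable M" for i
    by (rule borel_measurable_simple_function[OF simple_function_compose1[OF g(1)]])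
  have h_simple: "simple_function M (h i)" for i
    unfolding h_def by (rule simple_function_If[OF g(1) simple_function_const]) measurable
  have h_le: "norm (h i x) \<le> 2 * norm (f x)" for i x
    by (auto simp: h_def)
  have diff_meas [measurable]: "(\<lambda>x. norm (f x - h i x)) \<in> borel_measurable M" for i
    by (rule borel_measurable_norm_strongly_measurable[OF assms(1)
          strongly_measurable_diff[OF f simple_function_strongly_measurable[OF h_simple]]])
  have h_int: "Bochner_Integration.simple_bochner_integrable M (h i)" for i
  proof (rule simple_bochner_integrableI_bounded[OF h_simple])
    have "(\<integral>\<^sup>+x. ennreal (norm (h i x)) \<partial>M) \<le> (\<integral>\<^sup>+x. 2 * ennreal (norm (f x)) \<partial>M)"
      using h_le by (intro nn_integral_mono) (simp flip: ennreal_numeral ennreal_mult)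
    also have "\<dots> < \<infinity>"
      using fin by (simp add: nn_integral_cmult ennreal_mult_less_top)
    finally show "(\<integral>\<^sup>+x. ennreal (norm (h i x)) \<partial>M) < \<infinity>" .
  qed
  have "(\<lambda>i. \<integral>\<^sup>+x. ennreal (norm (f x - h i x)) \<partial>M) \<longlonglongrightarrow> (\<integral>\<^sup>+x. 0 \<partial>M)"
  proof (rule nn_integral_dominated_convergence)
    show "AE x in M. ennreal (norm (f x - h i x)) \<le> 3 * ennreal (norm (f x))" for i
    proof (rule AE_I2)
      fix x
      have "norm (f x - h i x) \<le> 3 * norm (f x)"
        using norm_triangle_ineq4[of "f x" "h i x"] h_le[of i x] by simp
      then show "ennreal (norm (f x - h i x)) \<le> 3 * ennreal (norm (f x))"
        by (simp flip: ennreal_numeral ennreal_mult)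
    qed
    show "(\<integral>\<^sup>+x. 3 * ennreal (norm (f x)) \<partial>M) < \<infinity>"
      using fin by (simp add: nn_integral_cmult ennreal_mult_less_top)
    show "AE x in M. (\<lambda>i. ennreal (norm (f x - h i x))) \<longlonglongrightarrow> 0"
      using g(2)
    proof eventually_elim
      case (elim x)
      have "(\<lambda>i. h i x) \<longlonglongrightarrow> f x"
      proof (cases "f x = 0")
        case True
        then have "(\<lambda>i. h i x) = (\<lambda>i. 0)"
          by (auto simp: h_def)
        with True show ?thesis
          by simp
      next
        case False
        have "(\<lambda>i. norm (g i x)) \<longlonglongrightarrow> norm (f x)"
          using elim by (rule tendsto_norm)
        then have "eventually (\<lambda>i. norm (g i x) < 2 * norm (f x)) sequentially"
          by (rule order_tendstoD) (use False in auto)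
        then have "eventually (\<lambda>i. g i x = h i x) sequentially"
          by eventually_elim (auto simp: h_def)
        with elim show ?thesis
          by (rule Lim_transform_eventually)
      qed
      then have "(\<lambda>i. norm (f x - h i x)) \<longlonglongrightarrow> 0"
        by (intro tendsto_norm_zero) (auto intro!: tendsto_eq_intros)
      then show ?case
        using tendsto_ennrealI by fastforce
    qed
  qed auto
  then have lim: "(\<lambda>i. \<integral>\<^sup>+x. ennreal (norm (f x - h i x)) \<partial>M) \<longlonglongrightarrow> 0"
    by simp
  let ?I = "\<lambda>i. Bochner_Integration.simple_bochner_integral M (h i)"
  let ?E = "\<lambda>i. \<integral>\<^sup>+x. ennreal (norm (f x - h i x)) \<partial>M"
  \<comment> \<open>Passing through \<open>f\<close> bounds the distance of two integrals by two
    errors that tend to 0, which makes the integrals a Cauchy sequence.\<close>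
  have dist: "ennreal (dist (?I i) (?I j)) \<le> ?E i + ?E j" for i j
  proof -
    have "Bochner_Integration.simple_bochner_integrable M (\<lambda>x. h i x - h j x)"
      using h_int[of i] h_int[of j] by (rule simple_bochner_integrable_compose2[rotated]) simp
    moreover have "Bochner_Integration.simple_bochner_integrable M (\<lambda>x. norm (h i x - h j x))"
      using h_int[of i] h_int[of j]
      by (rule simple_bochner_integrable_compose2[of "\<lambda>x y. norm (x - y)", rotated]) simp
    ultimately have "ennreal (dist (?I i) (?I j)) \<le> (\<integral>\<^sup>+x. ennreal (norm (h i x - h j x)) \<partial>M)"
      using simple_bochner_integral_norm_bound[of M "\<lambda>x. h i x - h j x"]
        simple_bochner_integral_eq_nn_integral[of M "\<lambda>x. norm (h i x - h j x)"]
      by (simp add: dist_norm simple_bochner_integral_diff[OF h_int h_int, symmetric] flip: ennreal_le_iff)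
    also have "\<dots> \<le> (\<integral>\<^sup>+x. ennreal (norm (f x - h i x)) + ennreal (norm (f x - h j x)) \<partial>M)"
    proof (rule nn_integral_mono)
      fix x
      have "norm (h i x - h j x) \<le> norm (f x - h i x) + norm (f x - h j x)"
        by (metis dist_norm dist_triangle3)
      then show "ennreal (norm (h i x - h j x)) \<le> ennreal (norm (f x - h i x)) + ennreal (norm (f x - h j x))"
        by (simp flip: ennreal_plus)
    qed
    also have "\<dots> = ?E i + ?E j"
      by (rule nn_integral_add) auto
    finally show ?thesis .
  qed
  have "Cauchy ?I"
  proof (rule metric_CauchyI)
    fix e :: real assume "0 < e"
    then have "eventually (\<lambda>i. ?E i < ennreal (e/2)) sequentially"
      by (intro order_tendstoD[OF lim]) simp
    then obtain N where N: "\<And>i. i \<ge> N \<Longrightarrow> ?E i < ennreal (e/2)"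
      by (auto simp: eventually_sequentially)
    have "dist (?I i) (?I j) < e" if "i \<ge> N" "j \<ge> N" for i j
    proof -
      have "ennreal (dist (?I i) (?I j)) < ennreal (e/2) + ennreal (e/2)"
        using dist[of i j] add_strict_mono[OF N[OF that(1)] N[OF that(2)]] by (rule le_less_trans)
      also have "\<dots> = ennreal e"
        using \<open>0 < e\<close> by (simp flip: ennreal_plus)
      finally show ?thesis
        by (simp add: ennreal_less_iff)
    qed
    then show "\<exists>N. \<forall>i\<ge>N. \<forall>j\<ge>N. dist (?I i) (?I j) < e"
      by blast
  qed
  then obtain x where "?I \<longlonglongrightarrow> x"
    by (auto simp: Cauchy_convergent_iff convergent_def)
  then have "has_Bochner_integral M f x"
    unfolding has_Bochner_integral_def using f h_int lim by blast
  then show thesis ..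
qed

text \<open>The bridge to scalar integrals, used for every later identity. By Cauchy--Schwarz the
  simple approximations, tested with \<open>v\<close>, converge in mean with the extra factor
  \<open>norm v\<close>.\<close>

lemma has_Bochner_integral_inner:
  fixes f :: "'b \<Rightarrow> 'a::real_inner"
  assumes "complete_measure M" and f: "has_Bochner_integral M f x"
  shows "has_bochner_integral M (\<lambda>y. inner (f y) v) (inner x v)"
proof -
  from f obtain g where sm: "strongly_measurable M f"
    and g: "\<And>i::nat. Bochner_Integration.simple_bochner_integrable M (g i)"
    and lim: "(\<lambda>i. \<integral>\<^sup>+ y. ennreal (norm (f y - g i y)) \<partial>M) \<longlonglongrightarrow> 0"
    and I: "(\<lambda>i. Bochner_Integration.simple_bochner_integral M (g i)) \<longlonglongrightarrow> x"
    unfolding has_Bochner_integral_def by blast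
  have [measurable]: "(\<lambda>y. inner (f y) v) \<in> borel_measurable M"
    by (rule borel_measurable_inner_strongly_measurable[OF assms(1) sm])
  have [measurable]: "(\<lambda>y. norm (f y - g i y)) \<in> borel_measurable M" for i
    using g[of i] by (intro borel_measurable_norm_strongly_measurable[OF assms(1)]
        strongly_measurable_diff[OF sm] simple_function_strongly_measurable)
      (auto elim: simple_bochner_integrable.cases)
  have g': "Bochner_Integration.simple_bochner_integrable M (\<lambda>y. inner (g i y) v)" for i
    using g[of i] g[of i] by (rule simple_bochner_integrable_compose2[of "\<lambda>x y. inner x v", rotated]) simp
  show ?thesis
  proof (rule has_bochner_integral.intros[of _ _ "\<lambda>i y. inner (g i y) v"])
    show "(\<lambda>i. \<integral>\<^sup>+ y. ennreal (norm (inner (f y) v - inner (g i y) v)) \<partial>M) \<longlonglongrightarrow> 0"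
    proof (rule tendsto_sandwich[OF _ _ tendsto_const[of 0]])
      show "eventually (\<lambda>i. (\<integral>\<^sup>+ y. ennreal (norm (inner (f y) v - inner (g i y) v)) \<partial>M)
          \<le> ennreal (norm v) * (\<integral>\<^sup>+ y. ennreal (norm (f y - g i y)) \<partial>M)) sequentially"
      proof (rule always_eventually, rule allI)
        fix i
        have "(\<integral>\<^sup>+ y. ennreal (norm (inner (f y) v - inner (g i y) v)) \<partial>M)
            \<le> (\<integral>\<^sup>+ y. ennreal (norm v) * ennreal (norm (f y - g i y)) \<partial>M)"
          by (intro nn_integral_mono)
            (simp add: inner_diff_left[symmetric] ennreal_mult[symmetric] mult.commute[of "norm v"] Cauchy_Schwarz_ineq2)
        also have "\<dots> = ennreal (norm v) * (\<integral>\<^sup>+ y. ennreal (norm (f y - g i y)) \<partial>M)"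
          by (rule nn_integral_cmult) measurable
        finally show "(\<integral>\<^sup>+ y. ennreal (norm (inner (f y) v - inner (g i y) v)) \<partial>M)
          \<le> ennreal (norm v) * (\<integral>\<^sup>+ y. ennreal (norm (f y - g i y)) \<partial>M)" .
      qed
      show "(\<lambda>i. ennreal (norm v) * (\<integral>\<^sup>+ y. ennreal (norm (f y - g i y)) \<partial>M)) \<longlonglongrightarrow> 0"
        using ennreal_tendsto_cmult[OF _ lim, of "ennreal (norm v)"] by simp
    qed auto
    show "(\<lambda>i. Bochner_Integration.simple_bochner_integral M (\<lambda>y. inner (g i y) v)) \<longlonglongrightarrow> inner x v"
    proof -
      have "Bochner_Integration.simple_bochner_integral M (\<lambda>y. inner (g i y) v)
          = inner (Bochner_Integration.simple_bochner_integral M (g i)) v" for i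
        by (rule simple_bochner_integral_linear[OF _ g])
          (auto intro!: bounded_linear.linear bounded_linear_inner_left)
      with tendsto_inner[OF I tendsto_const[of v]] show ?thesis
        by simp
    qed
  qed (use g' in auto)
qed

lemma has_Bochner_integral_unique:
  fixes f :: "'b \<Rightarrow> 'a::real_inner"
  assumes "complete_measure M" "has_Bochner_integral M f x" "has_Bochner_integral M f y"
  shows "x = y"
proof -
  have "inner x v = inner y v" for v
    using has_Bochner_integral_inner[OF assms(1,2)] has_Bochner_integral_inner[OF assms(1,3)]
    by (rule has_bochner_integral_eq)
  then show ?thesis
    by (metis vector_eq_rdot)
qed

lemma has_Bochner_integral_Bochner_integral:
  fixes f :: "'b \<Rightarrow> 'a::real_inner"
  assumes "complete_measure M" "Bochner_integrable M f"
  shows "has_Bochner_integral M f (Bochner_integral M f)"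
  using assms has_Bochner_integral_unique[OF assms(1)]
  unfolding Bochner_integral_def Bochner_integrable_def by (auto intro: theI)

text \<open>Bochner's criterion. One half is the truncation argument above; for the other,
  \<open>f\<close> lies at finite mean distance from a single integrable simple function, which
  bounds the integral of its norm.\<close>

lemma Bochner_integrable_iff:
  fixes f :: "'b \<Rightarrow> 'a::{real_normed_vector, complete_space}"
  assumes "complete_measure M"
  shows "Bochner_integrable M f \<longleftrightarrow> strongly_measurable M f \<and> integrable M (\<lambda>x. norm (f x))"
proof
  assume "strongly_measurable M f \<and> integrable M (\<lambda>x. norm (f x))"
  then show "Bochner_integrable M f"
    unfolding Bochner_integrable_def integrable_iff_bounded
    using has_Bochner_integral_exists[OF assms, of f] by auto
next
  assume "Bochner_integrable M f"
  then obtain g where sm: "strongly_measurable M f"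
    and g: "\<And>i::nat. Bochner_Integration.simple_bochner_integrable M (g i)"
    and lim: "(\<lambda>i. \<integral>\<^sup>+ y. ennreal (norm (f y - g i y)) \<partial>M) \<longlonglongrightarrow> 0"
    unfolding Bochner_integrable_def has_Bochner_integral_def by blast
  have [measurable]: "(\<lambda>x. norm (f x)) \<in> borel_measurable M"
    by (rule borel_measurable_norm_strongly_measurable[OF assms sm])
  have "eventually (\<lambda>i. (\<integral>\<^sup>+ y. ennreal (norm (f y - g i y)) \<partial>M) < 1) sequentially"
    by (rule order_tendstoD[OF lim]) simp
  then obtain i where i: "(\<integral>\<^sup>+ y. ennreal (norm (f y - g i y)) \<partial>M) < 1"
    by (auto simp: eventually_sequentially)
  have sf: "simple_function M (g i)"
    using g[of i] by (auto elim: simple_bochner_integrable.cases)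
  have [measurable]: "(\<lambda>y. norm (f y - g i y)) \<in> borel_measurable M"
    by (rule borel_measurable_norm_strongly_measurable[OF assms
          strongly_measurable_diff[OF sm simple_function_strongly_measurable[OF sf]]])
  have [measurable]: "(\<lambda>y. norm (g i y)) \<in> borel_measurable M"
    by (rule borel_measurable_simple_function[OF simple_function_compose1[OF sf]])
  have "Bochner_Integration.simple_bochner_integrable M (\<lambda>x. norm (g i x))"
    using g[of i] g[of i] by (rule simple_bochner_integrable_compose2[of "\<lambda>x y. norm x", rotated]) simp
  then have fin: "(\<integral>\<^sup>+ y. ennreal (norm (g i y)) \<partial>M) < \<infinity>"
    using simple_bochner_integral_eq_nn_integral[of M "\<lambda>x. norm (g i x)"]
    by (metis ennreal_less_top infinity_ennreal_def norm_ge_zero)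
  have "(\<integral>\<^sup>+ y. ennreal (norm (f y)) \<partial>M)
      \<le> (\<integral>\<^sup>+ y. ennreal (norm (f y - g i y)) + ennreal (norm (g i y)) \<partial>M)"
  proof (rule nn_integral_mono)
    fix x
    have "norm (f x) \<le> norm (f x - g i x) + norm (g i x)"
      using norm_triangle_sub[of "f x" "g i x"] by simp
    then show "ennreal (norm (f x)) \<le> ennreal (norm (f x - g i x)) + ennreal (norm (g i x))"
      by (simp flip: ennreal_plus)
  qed
  also have "\<dots> = (\<integral>\<^sup>+ y. ennreal (norm (f y - g i y)) \<partial>M) + (\<integral>\<^sup>+ y. ennreal (norm (g i y)) \<partial>M)"
    by (rule nn_integral_add) auto
  also have "\<dots> < \<infinity>"
    using i fin by (metis ennreal_add_less_top infinity_ennreal_def less_trans ennreal_one_less_top)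
  finally show "strongly_measurable M f \<and> integrable M (\<lambda>x. norm (f x))"
    using sm by (auto simp: integrable_iff_bounded)
qed

lemma
  fixes f :: "'b \<Rightarrow> 'a::real_inner"
  assumes "complete_measure M" "Bochner_integrable M f"
  shows integrable_inner_Bochner: "integrable M (\<lambda>x. inner (f x) v)"
    and inner_Bochner_integral: "inner (Bochner_integral M f) v = (LINT x|M. inner (f x) v)"
  using has_Bochner_integral_inner[OF assms(1) has_Bochner_integral_Bochner_integral[OF assms], of v]
  by (auto simp: has_bochner_integral_iff)

section \<open>Scalar integrals over intervals\<close>

lemma
  fixes g :: "real \<Rightarrow> real"
  shows integrable_lebesgue_on_Ioo_iff:
      "integrable (lebesgue_on {a<..<b}) g \<longleftrightarrow> integrable (lebesgue_on {a..b}) g"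
    and LINT_lebesgue_on_Ioo:
      "(LINT s|lebesgue_on {a<..<b}. g s) = (LINT s|lebesgue_on {a..b}. g s)"
proof -
  have iff: "integrable (lebesgue_on S) g \<longleftrightarrow> g absolutely_integrable_on S"
    if "S \<in> sets lebesgue" for S
    using that by (simp add: integrable_restrict_space set_integrable_def)
  show *: "integrable (lebesgue_on {a<..<b}) g \<longleftrightarrow> integrable (lebesgue_on {a..b}) g"
    by (simp add: iff absolutely_integrable_on_Icc_iff_Ioo)
  show "(LINT s|lebesgue_on {a<..<b}. g s) = (LINT s|lebesgue_on {a..b}. g s)"
  proof (cases "integrable (lebesgue_on {a..b}) g")
    case True
    with * show ?thesis
      by (simp add: lebesgue_integral_eq_integral integral_open_interval_real)
  next
    \<comment> \<open>Without integrability both integrals take the default value 0.\<close>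
    case False
    with * show ?thesis
      by (simp add: not_integrable_integral_eq)
  qed
qed

lemma integrable_lebesgue_on_continuous_mult:
  fixes g w :: "real \<Rightarrow> real"
  assumes g: "integrable (lebesgue_on {a..b}) g" and w: "continuous_on {a..b} w"
  shows "integrable (lebesgue_on {a..b}) (\<lambda>s. w s * g s)"
proof -
  have "bounded (w ` {a..b})"
    using w by (intro compact_imp_bounded compact_continuous_image) auto
  then obtain K where K: "\<And>s. s \<in> {a..b} \<Longrightarrow> \<bar>w s\<bar> \<le> K"
    unfolding bounded_iff by (metis image_eqI real_norm_def)
  have [measurable]: "w \<in> borel_measurable (lebesgue_on {a..b})"
    using w by (rule continuous_imp_measurable_on_sets_lebesgue) simp
  have [measurable]: "g \<in> borel_measurable (lebesgue_on {a..b})"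
    using g by (rule borel_measurable_integrable)
  show ?thesis
  proof (rule Bochner_Integration.integrable_bound)
    show "integrable (lebesgue_on {a..b}) (\<lambda>s. K * \<bar>g s\<bar>)"
      using g by (intro integrable_mult_right integrable_abs)
    show "AE s in lebesgue_on {a..b}. norm (w s * g s) \<le> norm (K * \<bar>g s\<bar>)"
    proof (rule AE_I2)
      fix s assume "s \<in> space (lebesgue_on {a..b})"
      then have "\<bar>w s\<bar> \<le> K"
        using K by simp
      then have "\<bar>w s\<bar> * \<bar>g s\<bar> \<le> \<bar>K\<bar> * \<bar>g s\<bar>"
        by (intro mult_right_mono) auto
      then show "norm (w s * g s) \<le> norm (K * \<bar>g s\<bar>)"
        by (simp add: abs_mult)
    qed
  qed measurable
qed

lemma continuous_on_imp_integrable_lebesgue_on: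
  fixes w :: "real \<Rightarrow> real"
  assumes "continuous_on {a..b} w"
  shows "integrable (lebesgue_on {a..b}) w"
  using integrable_lebesgue_on_continuous_mult[OF _ assms, of "\<lambda>_. 1"]
  by (simp add: finite_measure.integrable_const finite_measure_lebesgue_on)

section \<open>Projections onto finite-dimensional spaces\<close>

text \<open>Gram--Schmidt inside the induction: the hypothesis for \<open>inner b\<close> yields the
  projection \<open>p\<close> of \<open>b\<close> onto \<open>span B\<close>, and
  \<open>w = b - p\<close> is the new orthogonal direction. The representer is corrected along
  \<open>w\<close> by \<open>l w / inner w w\<close>; if \<open>w = 0\<close>, the span has not
  grown.\<close>

lemma Riesz_span:
  fixes B :: "'a::real_inner set"
  assumes "finite B" "linear l"
  shows "\<exists>y\<in>span B. \<forall>v\<in>span B. inner y v = l v"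
  using assms
proof (induction B arbitrary: l rule: finite_induct)
  case empty
  then show ?case
    by (auto simp: linear_0)
next
  case (insert b B)
  have "linear (inner b)"
    by (rule bounded_linear.linear[OF bounded_linear_inner_right])
  from insert.IH[OF this] obtain p
    where p: "p \<in> span B" "\<And>v. v \<in> span B \<Longrightarrow> inner p v = inner b v" by blast
  from insert.IH[OF insert.prems] obtain y
    where y: "y \<in> span B" "\<And>v. v \<in> span B \<Longrightarrow> inner y v = l v" by blast
  define w where "w = b - p"
  have w: "inner w v = 0" if "v \<in> span B" for v
    using p(2)[OF that] by (simp add: w_def inner_diff_left)
  show ?case
  proof (cases "w = 0")
    case True
    then have "b \<in> span B"
      using p(1) by (simp add: w_def)
    then have "span (insert b B) = span B"
      by (rule span_redundant)
    with y show ?thesis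
      by auto
  next
    case False
    define c where "c = l w / inner w w"
    have "y + c *\<^sub>R w \<in> span (insert b B)"
      unfolding w_def
      by (intro span_add span_scale span_diff span_base insertI1 span_mono[THEN subsetD, OF _ y(1)]
          span_mono[THEN subsetD, OF _ p(1)]) auto
    moreover have "inner (y + c *\<^sub>R w) v = l v" if v: "v \<in> span (insert b B)" for v
    proof -
      from v obtain k where k: "v - k *\<^sub>R b \<in> span B"
        by (auto simp: span_breakdown_eq)
      define z where "z = v - k *\<^sub>R w"
      have "z = (v - k *\<^sub>R b) + k *\<^sub>R p"
        by (simp add: z_def w_def algebra_simps)
      then have z: "z \<in> span B"
        using k p(1) by (simp add: span_add span_scale)
      have v_eq: "v = z + k *\<^sub>R w"
        by (simp add: z_def)
      have "inner y w = 0"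
        using w[OF y(1)] by (simp add: inner_commute)
      then have "inner (y + c *\<^sub>R w) v = inner y z + c * k * inner w w"
        using w[OF z] by (simp add: v_eq inner_simps)
      also have "\<dots> = l z + k * l w"
        using y(2)[OF z] False by (simp add: c_def)
      also have "\<dots> = l v"
        using insert.prems by (simp add: v_eq linear_add linear_scale)
      finally show ?thesis .
    qed
    ultimately show ?thesis
      by blast
  qed
qed

text \<open>The representer of \<open>inner x\<close> is a projection, and the difference of two
  projections lies in the span and is orthogonal to itself; together this gives meaning to the
  definite description in \<open>orth_proj\<close>.\<close>

lemma
  fixes B :: "'a::real_inner set"
  assumes "finite B"
  shows orth_proj_in_span: "orth_proj (span B) x \<in> span B"
    and inner_orth_proj_span: "v \<in> span B \<Longrightarrow> inner (orth_proj (span B) x) v = inner x v"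
proof -
  have "linear (inner x)"
    by (rule bounded_linear.linear[OF bounded_linear_inner_right])
  from Riesz_span[OF assms this] obtain y where y: "y \<in> span B" "\<forall>v\<in>span B. inner y v = inner x v"
    by blast
  have "\<exists>!y. y \<in> span B \<and> (\<forall>v\<in>span B. inner (x - y) v = 0)"
  proof (rule ex1I[of _ y])
    show "y \<in> span B \<and> (\<forall>v\<in>span B. inner (x - y) v = 0)"
      using y by (auto simp: inner_diff_left)
    fix z assume z: "z \<in> span B \<and> (\<forall>v\<in>span B. inner (x - z) v = 0)"
    then have "z - y \<in> span B"
      using y(1) by (auto intro: span_diff)
    then have "inner (z - y) (z - y) = 0"
      using y(2) z by (simp add: inner_diff_left)
    then show "z = y"
      by simp
  qed
  from theI'[OF this]
  have P: "orth_proj (span B) x \<in> span B \<and> (\<forall>v\<in>span B. inner (x - orth_proj (span B) x) v = 0)"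
    unfolding orth_proj_def .
  then show "orth_proj (span B) x \<in> span B" by blast
  show "inner (orth_proj (span B) x) v = inner x v" if "v \<in> span B"
    using P that by (simp add: inner_diff_left)
qed

text \<open>Testing with the coefficient \<open>c i\<close> itself gives a real polynomial with
  infinitely many roots whose coefficient of order \<open>i\<close> is
  \<open>inner (c i) (c i)\<close>.\<close>

lemma polynomial_eq_0_on_interval:
  fixes c :: "nat \<Rightarrow> 'a::real_inner"
  assumes "a < b" "\<And>s. s \<in> {a..b} \<Longrightarrow> (\<Sum>i\<le>n. s ^ i *\<^sub>R c i) = 0" "i \<le> n"
  shows "c i = 0"
proof -
  have "infinite {s. (\<Sum>k\<le>n. inner (c k) (c i) * s ^ k) = 0}"
  proof (rule infinite_super)
    have "(\<Sum>k\<le>n. inner (c k) (c i) * s ^ k) = inner (\<Sum>k\<le>n. s ^ k *\<^sub>R c k) (c i)" for s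
      by (simp add: inner_sum_left mult.commute)
    then show "{a..b} \<subseteq> {s. (\<Sum>k\<le>n. inner (c k) (c i) * s ^ k) = 0}"
      using assms(2) by auto
  qed (use \<open>a < b\<close> in simp)
  then have "\<not> (\<exists>k\<le>n. inner (c k) (c i) \<noteq> 0)"
    using polyfun_finite_roots[of "\<lambda>k. inner (c k) (c i)" n] by blast
  with \<open>i \<le> n\<close> show ?thesis
    by auto
qed

text \<open>The new unknown is eliminated with a vector \<open>w\<close> that is \<open>G\<close>-orthogonal to the first \<open>n\<close> unit vectors.\<close>

lemma positive_definite_solvable:
  fixes G :: "nat \<Rightarrow> nat \<Rightarrow> real"
  assumes pos: "\<And>n w. \<exists>i\<le>n. w i \<noteq> 0 \<Longrightarrow> 0 < (\<Sum>j\<le>n. \<Sum>i\<le>n. w i * w j * G i j)"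
  shows "\<exists>c. \<forall>j\<le>n. (\<Sum>i\<le>n. G i j * c i) = y j"
proof (induction n arbitrary: y)
  case 0
  have "G 0 0 > 0"
    using pos[of 0 "\<lambda>_. 1"] by simp
  then show ?case
    by (intro exI[of _ "\<lambda>_. y 0 / G 0 0"]) simp
next
  case (Suc n)
  from Suc[of "G (Suc n)"] obtain a where a: "\<And>j. j \<le> n \<Longrightarrow> (\<Sum>i\<le>n. G i j * a i) = G (Suc n) j"
    by blast
  from Suc[of y] obtain b where b: "\<And>j. j \<le> n \<Longrightarrow> (\<Sum>i\<le>n. G i j * b i) = y j"
    by blast
  define w where "w i = (if i \<le> n then - a i else 1)" for i
  have w: "(\<Sum>i\<le>Suc n. G i j * w i) = G (Suc n) j - (\<Sum>i\<le>n. G i j * a i)" for j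
    by (simp add: w_def sum_negf)
  \<comment> \<open>This is the Schur complement of the leading block. By the orthogonality of
    \<open>w\<close> it equals the quadratic form at \<open>w\<close>, so it is positive, and a
    multiple of \<open>w\<close> can repair the last equation without disturbing the others.\<close>
  define q where "q = (\<Sum>i\<le>Suc n. G i (Suc n) * w i)"
  have "q = (\<Sum>j\<le>Suc n. w j * (\<Sum>i\<le>Suc n. G i j * w i))"
  proof -
    have "(\<Sum>j\<le>n. w j * (\<Sum>i\<le>Suc n. G i j * w i)) = 0"
      by (intro sum.neutral) (simp add: w a del: sum.atMost_Suc)
    then show ?thesis
      by (simp add: q_def w_def)
  qed
  also have "\<dots> = (\<Sum>j\<le>Suc n. \<Sum>i\<le>Suc n. w i * w j * G i j)"
    by (simp add: sum_distrib_left mult_ac del: sum.atMost_Suc)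
  also have "\<dots> > 0"
    by (rule pos) (auto simp: w_def intro!: exI[of _ "Suc n"])
  finally have q: "q > 0" .
  define t where "t = (y (Suc n) - (\<Sum>i\<le>n. G i (Suc n) * b i)) / q"
  define c where "c i = (if i \<le> n then b i else 0) + t * w i" for i
  have c: "(\<Sum>i\<le>Suc n. G i j * c i) = (\<Sum>i\<le>n. G i j * b i) + t * (\<Sum>i\<le>Suc n. G i j * w i)" for j
    by (simp add: c_def algebra_simps sum.distrib sum_distrib_left)
  have "(\<Sum>i\<le>Suc n. G i j * c i) = y j" if "j \<le> Suc n" for j
  proof (cases "j \<le> n")
    case True
    then show ?thesis
      unfolding c by (simp add: w a b del: sum.atMost_Suc)
  next
    case False
    then have "j = Suc n"
      using that by simp
    then show ?thesis
      unfolding c using q by (simp add: q_def[symmetric] t_def del: sum.atMost_Suc)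
  qed
  then show ?case
    by blast
qed

text \<open>The double sum is the integral of the square of the polynomial with coefficients
  \<open>w\<close>. If it vanished, the polynomial would vanish on the interval, and so would its
  coefficients.\<close>

lemma monomial_Gram_positive_definite:
  fixes w :: "nat \<Rightarrow> real"
  assumes "a < b" "\<exists>i\<le>n. w i \<noteq> 0"
  shows "0 < (\<Sum>j\<le>n. \<Sum>i\<le>n. w i * w j * (LINT s|lebesgue_on {a..b}. s ^ (i + j)))"
proof -
  define p where "p s = (\<Sum>i\<le>n. s ^ i *\<^sub>R w i)" for s :: real
  have p_cont: "continuous_on {a..b} (\<lambda>s. (p s)\<^sup>2)"
    unfolding p_def by (intro continuous_intros)
  have int: "integrable (lebesgue_on {a..b}) (\<lambda>s. w i * w j * s ^ (i + j))" for i j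
    by (intro continuous_on_imp_integrable_lebesgue_on continuous_intros)
  have "(\<Sum>j\<le>n. \<Sum>i\<le>n. w i * w j * (LINT s|lebesgue_on {a..b}. s ^ (i + j)))
      = (LINT s|lebesgue_on {a..b}. (\<Sum>j\<le>n. \<Sum>i\<le>n. w i * w j * s ^ (i + j)))"
    using int by (subst Bochner_Integration.integral_sum, simp,
        subst Bochner_Integration.integral_sum, simp_all)
  also have "(\<lambda>s. \<Sum>j\<le>n. \<Sum>i\<le>n. w i * w j * s ^ (i + j)) = (\<lambda>s. (p s)\<^sup>2)"
    by (simp add: p_def power2_eq_square sum_product power_add mult_ac)
  also have "(LINT s|lebesgue_on {a..b}. (p s)\<^sup>2) = integral {a..b} (\<lambda>s. (p s)\<^sup>2)"
    by (rule lebesgue_integral_eq_integral)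
      (use continuous_on_imp_integrable_lebesgue_on[OF p_cont] in auto)
  finally have eq: "(\<Sum>j\<le>n. \<Sum>i\<le>n. w i * w j * (LINT s|lebesgue_on {a..b}. s ^ (i + j)))
      = integral {a..b} (\<lambda>s. (p s)\<^sup>2)" .
  have "integral {a..b} (\<lambda>s. (p s)\<^sup>2) \<noteq> 0"
  proof
    assume "integral {a..b} (\<lambda>s. (p s)\<^sup>2) = 0"
    then have "\<forall>s\<in>{a..b}. (p s)\<^sup>2 = 0"
      using integral_eq_0_iff[OF p_cont \<open>a < b\<close>] by auto
    then have "w i = 0" if "i \<le> n" for i
      using polynomial_eq_0_on_interval[OF \<open>a < b\<close> _ that, of w] by (auto simp: p_def)
    with assms(2) show False
      by blast
  qed
  moreover have "integral {a..b} (\<lambda>s. (p s)\<^sup>2) \<ge> 0"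
    by (intro integral_nonneg integrable_continuous_real p_cont) auto
  ultimately show ?thesis
    unfolding eq by simp
qed

lemma continuous_on_poly_space:
  fixes p :: "real \<Rightarrow> 'a::real_normed_vector"
  assumes "p \<in> poly_space r S"
  shows "continuous_on A p"
  using assms by (auto simp: poly_space_def intro!: continuous_intros)

lemma poly_space_diff:
  assumes "subspace S" "p \<in> poly_space r S" "q \<in> poly_space r S"
  shows "(\<lambda>s. p s - q s) \<in> poly_space r S"
proof -
  from assms obtain c d where "\<forall>i\<le>r. c i \<in> S" "p = (\<lambda>s. \<Sum>i\<le>r. s ^ i *\<^sub>R c i)"
    "\<forall>i\<le>r. d i \<in> S" "q = (\<lambda>s. \<Sum>i\<le>r. s ^ i *\<^sub>R d i)"
    unfolding poly_space_def by blast
  with assms(1) show ?thesis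
    unfolding poly_space_def
    by (intro CollectI exI[of _ "\<lambda>i. c i - d i"])
      (auto simp: sum_subtractf scaleR_diff_right intro: subspace_diff)
qed

lemma const_in_poly_space:
  assumes "subspace S" "v \<in> S"
  shows "(\<lambda>s. v) \<in> poly_space r S"
proof -
  have "(\<Sum>i\<le>r. s ^ i *\<^sub>R (if i = 0 then v else 0)) = v" for s :: real
    by (subst sum.remove[of _ 0]) auto
  then show ?thesis
    unfolding poly_space_def using assms
    by (intro CollectI exI[of _ "\<lambda>i. if i = 0 then v else 0"]) (auto simp: subspace_0)
qed

text \<open>The problem splits into time and space. With \<open>y j\<close> the Riesz representer of
  \<open>\<lambda>v. LINT s|lebesgue_on {a..b}. s ^ j * inner (f s) v\<close>, the coefficients of
  the projection solve a linear system with the scalar Gram matrix of the monomials and right-hand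
  side \<open>y\<close>.\<close>

lemma L2_proj_exists:
  fixes f :: "real \<Rightarrow> 'a::real_inner"
  assumes "a < b" "finite B"
    and f: "\<And>v. integrable (lebesgue_on {a..b}) (\<lambda>s. inner (f s) v)"
  shows "\<exists>p\<in>poly_space r (span B). \<forall>V\<in>poly_space r (span B).
    (LINT s|lebesgue_on {a..b}. inner (p s - f s) (V s)) = 0"
proof -
  let ?L = "\<lambda>g. LINT s|lebesgue_on {a..b}. g s"
  define G where "G i j = ?L (\<lambda>s. s ^ (i + j))" for i j
  define l where "l j v = ?L (\<lambda>s. s ^ j * inner (f s) v)" for j v
  have int_f: "integrable (lebesgue_on {a..b}) (\<lambda>s. s ^ j * inner (f s) v)" for j v
    by (intro integrable_lebesgue_on_continuous_mult f continuous_intros)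
  have "linear (l j)" for j
  proof (rule linearI)
    fix v w c
    show "l j (v + w) = l j v + l j w"
      unfolding l_def inner_add_right distrib_left by (rule Bochner_Integration.integral_add[OF int_f int_f])
    have "l j (c *\<^sub>R v) = ?L (\<lambda>s. c * (s ^ j * inner (f s) v))"
      by (simp add: l_def mult_ac)
    also have "\<dots> = c *\<^sub>R l j v"
      by (simp add: l_def)
    finally show "l j (c *\<^sub>R v) = c *\<^sub>R l j v" .
  qed
  then have "\<forall>j. \<exists>y. y \<in> span B \<and> (\<forall>v\<in>span B. inner y v = l j v)"
    using Riesz_span[OF \<open>finite B\<close>] by blast
  from choice[OF this] obtain y
    where y: "\<And>j. y j \<in> span B" "\<And>j v. v \<in> span B \<Longrightarrow> inner (y j) v = l j v"
    by blast
  have "\<forall>k. \<exists>d. \<forall>j\<le>r. (\<Sum>i\<le>r. G i j * d i) = (if j = k then 1 else 0)"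
  proof
    fix k
    show "\<exists>d. \<forall>j\<le>r. (\<Sum>i\<le>r. G i j * d i) = (if j = k then 1 else 0)"
      unfolding G_def
      by (rule positive_definite_solvable[OF monomial_Gram_positive_definite[OF \<open>a < b\<close>]])
  qed
  from choice[OF this] obtain d
    where d: "\<And>k j. j \<le> r \<Longrightarrow> (\<Sum>i\<le>r. G i j * d k i) = (if j = k then 1 else 0)"
    by blast
  \<comment> \<open>The vectors \<open>d k\<close> are the columns of the inverse Gram matrix, so
    the scalar inverse is applied here to a vector-valued right-hand side and the result stays in
    \<open>span B\<close>.\<close>
  define c where "c i = (\<Sum>k\<le>r. d k i *\<^sub>R y k)" for i
  have c: "c i \<in> span B" for i
    unfolding c_def by (intro span_sum span_scale y)
  have Gc: "(\<Sum>i\<le>r. G i j *\<^sub>R c i) = y j" if "j \<le> r" for j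
  proof -
    have "(\<Sum>i\<le>r. G i j *\<^sub>R c i) = (\<Sum>k\<le>r. (\<Sum>i\<le>r. G i j * d k i) *\<^sub>R y k)"
      unfolding c_def scaleR_sum_right scaleR_sum_left by (subst sum.swap) simp
    also have "\<dots> = (\<Sum>k\<le>r. if j = k then y k else 0)"
      using that by (intro sum.cong) (auto simp: d)
    also have "\<dots> = y j"
      using that by simp
    finally show ?thesis .
  qed
  define p where "p s = (\<Sum>i\<le>r. s ^ i *\<^sub>R c i)" for s
  have "p \<in> poly_space r (span B)"
    unfolding poly_space_def p_def[abs_def] using c by (intro CollectI exI[of _ c]) auto
  moreover have "?L (\<lambda>s. inner (p s - f s) (V s)) = 0" if V: "V \<in> poly_space r (span B)" for V
  proof -
    from V obtain v where v: "\<And>i. i \<le> r \<Longrightarrow> v i \<in> span B" "V = (\<lambda>s. \<Sum>i\<le>r. s ^ i *\<^sub>R v i)"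
      unfolding poly_space_def by blast
    have int_c: "integrable (lebesgue_on {a..b}) (\<lambda>s. s ^ (i + j) * inner (c i) (v j))" for i j
      by (intro continuous_on_imp_integrable_lebesgue_on continuous_intros)
    have "inner (p s - f s) (V s) =
        (\<Sum>j\<le>r. (\<Sum>i\<le>r. s ^ (i + j) * inner (c i) (v j)) - s ^ j * inner (f s) (v j))" for s
      by (simp add: p_def v(2) inner_diff_left inner_sum_left inner_sum_right sum_subtractf
          sum_distrib_left power_add right_diff_distrib mult_ac)
    then have "?L (\<lambda>s. inner (p s - f s) (V s)) =
        ?L (\<lambda>s. \<Sum>j\<le>r. (\<Sum>i\<le>r. s ^ (i + j) * inner (c i) (v j)) - s ^ j * inner (f s) (v j))"
      by simp
    also have "\<dots> = (\<Sum>j\<le>r. ?L (\<lambda>s. (\<Sum>i\<le>r. s ^ (i + j) * inner (c i) (v j)) - s ^ j * inner (f s) (v j)))"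
      using int_c int_f by (intro Bochner_Integration.integral_sum
          Bochner_Integration.integrable_diff Bochner_Integration.integrable_sum)
    also have "\<dots> = (\<Sum>j\<le>r. (\<Sum>i\<le>r. G i j * inner (c i) (v j)) - l j (v j))"
    proof (rule sum.cong[OF refl])
      fix j
      have "?L (\<lambda>s. (\<Sum>i\<le>r. s ^ (i + j) * inner (c i) (v j)) - s ^ j * inner (f s) (v j))
         = ?L (\<lambda>s. \<Sum>i\<le>r. s ^ (i + j) * inner (c i) (v j)) - l j (v j)"
        unfolding l_def using int_c int_f
        by (intro Bochner_Integration.integral_diff Bochner_Integration.integrable_sum)
      also have "?L (\<lambda>s. \<Sum>i\<le>r. s ^ (i + j) * inner (c i) (v j)) = (\<Sum>i\<le>r. ?L (\<lambda>s. s ^ (i + j) * inner (c i) (v j)))"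
        using int_c by (intro Bochner_Integration.integral_sum)
      finally show "?L (\<lambda>s. (\<Sum>i\<le>r. s ^ (i + j) * inner (c i) (v j)) - s ^ j * inner (f s) (v j))
         = (\<Sum>i\<le>r. G i j * inner (c i) (v j)) - l j (v j)"
        by (simp add: G_def)
    qed
    also have "\<dots> = (\<Sum>j\<le>r. inner (\<Sum>i\<le>r. G i j *\<^sub>R c i) (v j) - l j (v j))"
      by (simp add: inner_sum_left)
    also have "\<dots> = 0"
      using v(1) by (intro sum.neutral) (auto simp: Gc y(2))
    finally show ?thesis .
  qed
  ultimately show ?thesis
    by blast
qed

text \<open>The difference \<open>h\<close> is an admissible test function, and testing both
  conditions with it makes its mean square over \<open>{a..b}\<close> vanish. Its coefficients are
  then zero, which gives equality on the whole line.\<close>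

lemma L2_proj_unique:
  fixes f :: "real \<Rightarrow> 'a::real_inner"
  assumes "a < b" "subspace S"
    and f: "\<And>v. integrable (lebesgue_on {a..b}) (\<lambda>s. inner (f s) v)"
    and p: "p \<in> poly_space r S"
      "\<And>V. V \<in> poly_space r S \<Longrightarrow> (LINT s|lebesgue_on {a..b}. inner (p s - f s) (V s)) = 0"
    and q: "q \<in> poly_space r S"
      "\<And>V. V \<in> poly_space r S \<Longrightarrow> (LINT s|lebesgue_on {a..b}. inner (q s - f s) (V s)) = 0"
  shows "p = q"
proof -
  define h where "h s = p s - q s" for s
  have h: "h \<in> poly_space r S"
    unfolding h_def using assms by (intro poly_space_diff)
  then obtain c where c: "h = (\<lambda>s. \<Sum>i\<le>r. s ^ i *\<^sub>R c i)"
    unfolding poly_space_def by blast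
  have h_cont: "continuous_on {a..b} (\<lambda>s. inner (h s) (h s))"
    using continuous_on_poly_space[OF h] by (intro continuous_intros)
  have int: "integrable (lebesgue_on {a..b}) (\<lambda>s. inner (g s - f s) (h s))" if "g \<in> poly_space r S" for g
  proof -
    have "integrable (lebesgue_on {a..b}) (\<lambda>s. \<Sum>i\<le>r. s ^ i * inner (f s) (c i))"
      by (intro Bochner_Integration.integrable_sum integrable_lebesgue_on_continuous_mult f continuous_intros)
    also have "(\<lambda>s. \<Sum>i\<le>r. s ^ i * inner (f s) (c i)) = (\<lambda>s. inner (f s) (h s))"
      by (simp add: c inner_sum_right)
    finally have "integrable (lebesgue_on {a..b}) (\<lambda>s. inner (f s) (h s))" .
    moreover have "integrable (lebesgue_on {a..b}) (\<lambda>s. inner (g s) (h s))"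
      by (intro continuous_on_imp_integrable_lebesgue_on continuous_intros continuous_on_poly_space[OF that]
          continuous_on_poly_space[OF h])
    ultimately show ?thesis
      unfolding inner_diff_left by (rule Bochner_Integration.integrable_diff[rotated])
  qed
  have "(LINT s|lebesgue_on {a..b}. inner (h s) (h s)) =
      (LINT s|lebesgue_on {a..b}. inner (p s - f s) (h s) - inner (q s - f s) (h s))"
    by (simp add: h_def inner_diff_left)
  also have "\<dots> = 0"
    using int[OF p(1)] int[OF q(1)] p(2)[OF h] q(2)[OF h] by simp
  finally have "integral {a..b} (\<lambda>s. inner (h s) (h s)) = 0"
    using lebesgue_integral_eq_integral[OF continuous_on_imp_integrable_lebesgue_on[OF h_cont]] by simp
  then have "\<forall>s\<in>{a..b}. inner (h s) (h s) = 0"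
    using integral_eq_0_iff[OF h_cont \<open>a < b\<close>] by auto
  then have "c i = 0" if "i \<le> r" for i
    using polynomial_eq_0_on_interval[OF \<open>a < b\<close> _ that, of c] by (auto simp: c)
  then have "h s = 0" for s
    by (simp add: c)
  then show ?thesis
    by (auto simp: h_def)
qed

lemma
  fixes f :: "real \<Rightarrow> 'a::real_inner"
  assumes "a < b" "finite B"
    and f: "\<And>v. integrable (lebesgue_on {a<..<b}) (\<lambda>s. inner (f s) v)"
  shows L2_proj_in_poly_space: "L2_proj {a<..<b} r (span B) f \<in> poly_space r (span B)"
    and L2_proj_orthogonal: "V \<in> poly_space r (span B) \<Longrightarrow>
      (LINT s|lebesgue_on {a<..<b}. inner (L2_proj {a<..<b} r (span B) f s - f s) (V s)) = 0"
proof -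
  have f': "integrable (lebesgue_on {a..b}) (\<lambda>s. inner (f s) v)" for v
    using f by (simp add: integrable_lebesgue_on_Ioo_iff)
  have "\<exists>!p. p \<in> poly_space r (span B) \<and>
      (\<forall>V\<in>poly_space r (span B). (LINT s|lebesgue_on {a<..<b}. inner (p s - f s) (V s)) = 0)"
    unfolding LINT_lebesgue_on_Ioo
    using L2_proj_exists[OF assms(1,2) f', of r] L2_proj_unique[OF assms(1) subspace_span f', of _ r B]
    by blast
  from theI'[OF this]
  show "L2_proj {a<..<b} r (span B) f \<in> poly_space r (span B)"
    "V \<in> poly_space r (span B) \<Longrightarrow>
      (LINT s|lebesgue_on {a<..<b}. inner (L2_proj {a<..<b} r (span B) f s - f s) (V s)) = 0"
    unfolding L2_proj_def by auto
qed

section \<open>Gronwall's inequality with an integrable coefficient\<close>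

text \<open>Since \<open>\<Lambda>\<close> is only continuous, \<open>[a, c]\<close> is divided into \<open>N\<close> pieces of equal \<open>\<Lambda>\<close>-increment
  \<open>x / N\<close>; each step gains a factor \<open>1 - x / N\<close>, and \<open>(1 - x / N)\<^sup>N\<close> tends to \<open>exp (- x)\<close>.\<close>

lemma Gronwall_increments:
  fixes z \<Lambda> :: "real \<Rightarrow> real"
  assumes "a \<le> c" and cont: "continuous_on {a..c} \<Lambda>"
    and mono: "\<And>s s'. a \<le> s \<Longrightarrow> s \<le> s' \<Longrightarrow> s' \<le> c \<Longrightarrow> \<Lambda> s \<le> \<Lambda> s'"
    and step: "\<And>s s'. a \<le> s \<Longrightarrow> s \<le> s' \<Longrightarrow> s' \<le> c \<Longrightarrow> z s' - z s \<le> z s' * (\<Lambda> s' - \<Lambda> s)"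
  shows "z c \<le> z a * exp (\<Lambda> c - \<Lambda> a)"
proof -
  define x where "x = \<Lambda> c - \<Lambda> a"
  have "x \<ge> 0"
    using mono[of a c] \<open>a \<le> c\<close> by (simp add: x_def)
  have *: "z c * (1 + (- x) / real N) ^ N \<le> z a" if "real N > x" for N
  proof (cases "x = 0")
    case True
    then show ?thesis
      using step[of a c] \<open>a \<le> c\<close> by (simp add: x_def)
  next
    case False
    with \<open>x \<ge> 0\<close> have "x > 0" by simp
    with that have N: "N > 0" by (cases N) auto
    \<comment> \<open>Since \<open>\<Lambda>\<close> may be constant on stretches, the division
      points come from the intermediate value theorem instead of an inverse; their order is
      recovered from the strictly increasing values in \<open>le\<close>.\<close>
    have "\<forall>i. \<exists>s. i \<le> N \<longrightarrow> s \<in> {a..c} \<and> \<Lambda> s = \<Lambda> a + real i * (x / N)"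
    proof
      fix i
      show "\<exists>s. i \<le> N \<longrightarrow> s \<in> {a..c} \<and> \<Lambda> s = \<Lambda> a + real i * (x / N)"
      proof (cases "i \<le> N")
        case True
        then have "real i * (x / N) \<le> real N * (x / N)"
          using \<open>x > 0\<close> by (intro mult_right_mono) auto
        then have "\<Lambda> a + real i * (x / N) \<le> \<Lambda> c"
          using N by (simp add: x_def)
        then show ?thesis
          using IVT'[of \<Lambda> a "\<Lambda> a + real i * (x / N)" c] \<open>a \<le> c\<close> cont \<open>x > 0\<close> by auto
      qed auto
    qed
    from choice[OF this] obtain s
      where s: "\<And>i. i \<le> N \<Longrightarrow> s i \<in> {a..c}" "\<And>i. i \<le> N \<Longrightarrow> \<Lambda> (s i) = \<Lambda> a + real i * (x / N)"
      by blast
    have le: "s i \<le> s (Suc i)" if "Suc i \<le> N" for i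
    proof (rule ccontr)
      assume "\<not> s i \<le> s (Suc i)"
      then have "\<Lambda> (s (Suc i)) \<le> \<Lambda> (s i)"
        using s(1)[of i] s(1)[of "Suc i"] that by (intro mono) auto
      then show False
        using that s(2)[of i] s(2)[of "Suc i"] divide_pos_pos[OF \<open>x > 0\<close>, of "real N"] N
        by (simp add: distrib_right add_divide_distrib)
    qed
    define k where "k = 1 + (- x) / real N"
    have "k > 0"
      using that N by (simp add: k_def field_simps)
    have ind: "z (s i) * k ^ i \<le> z a" if "i \<le> N" for i
      using that
    proof (induction i)
      case 0
      then show ?case
        using step[of a "s 0"] s(1)[of 0] s(2)[of 0] by simp
    next
      case (Suc i)
      have "z (s (Suc i)) * k \<le> z (s i)"
        using step[of "s i" "s (Suc i)"] le[of i] s(1)[of i] s(1)[of "Suc i"] s(2)[of i] s(2)[of "Suc i"] Suc.prems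
        by (simp add: k_def algebra_simps add_divide_distrib)
      then have "z (s (Suc i)) * k * k ^ i \<le> z (s i) * k ^ i"
        using \<open>k > 0\<close> by (intro mult_right_mono) auto
      with Suc show ?case
        by (simp add: mult_ac)
    qed
    \<comment> \<open>The point \<open>s N\<close> may differ from \<open>c\<close>, but
      \<open>\<Lambda>\<close> agrees at both, so \<open>step\<close> loses nothing; the same
      happens between \<open>a\<close> and \<open>s 0\<close>.\<close>
    have "z c \<le> z (s N)"
      using step[of "s N" c] s(1)[of N] s(2)[of N] N by (simp add: x_def)
    then have "z c * k ^ N \<le> z (s N) * k ^ N"
      using \<open>k > 0\<close> by (intro mult_right_mono) auto
    with ind[of N] show ?thesis
      by (simp add: k_def)
  qed
  have "z c * exp (- x) \<le> z a"
  proof (rule LIMSEQ_le_const2)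
    show "(\<lambda>N. z c * (1 + (- x) / real N) ^ N) \<longlonglongrightarrow> z c * exp (- x)"
      by (intro tendsto_mult tendsto_const tendsto_exp_limit_sequentially)
    obtain N0 where "x < real N0"
      using reals_Archimedean2 by blast
    then show "\<exists>N. \<forall>n\<ge>N. z c * (1 + (- x) / real n) ^ n \<le> z a"
      by (intro exI[of _ N0] allI impI *) linarith
  qed
  then have "z c * exp (- x) * exp x \<le> z a * exp x"
    by (rule mult_right_mono) simp
  then show ?thesis
    by (simp add: x_def mult.assoc flip: exp_add)
qed

text \<open>The right-hand side \<open>z\<close> of the inequality is increasing, so on
  \<open>{s..s'}\<close> the factor \<open>y\<close> is at most \<open>z s'\<close>. Pulling this
  constant out of the integral gives the increment condition, with the primitive of \<open>l\<close>
  as \<open>\<Lambda>\<close>.\<close>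

lemma Gronwall_integral:
  fixes l y :: "real \<Rightarrow> real"
  assumes "a \<le> c" and l: "integrable (lebesgue_on {a..c}) l"
    and l_nonneg: "\<And>s. s \<in> {a..c} \<Longrightarrow> 0 \<le> l s"
    and y: "continuous_on {a..c} y" and y_nonneg: "\<And>s. s \<in> {a..c} \<Longrightarrow> 0 \<le> y s"
    and le: "\<And>s. s \<in> {a..c} \<Longrightarrow> y s \<le> \<psi> + integral {a..s} (\<lambda>x. l x * y x)"
  shows "y c \<le> \<psi> * exp (integral {a..c} l)"
proof -
  have l_int: "l integrable_on {a..c}"
    using l by (intro integrable_on_lebesgue_on) auto
  have ly_int: "(\<lambda>x. l x * y x) integrable_on {a..c}"
    using integrable_lebesgue_on_continuous_mult[OF l y]
    by (intro integrable_on_lebesgue_on) (auto simp: mult.commute)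
  define z where "z s = \<psi> + integral {a..s} (\<lambda>x. l x * y x)" for s
  have split: "integral {a..s'} g - integral {a..s} g = integral {s..s'} g"
    if "g integrable_on {a..c}" "a \<le> s" "s \<le> s'" "s' \<le> c" for s s' and g :: "real \<Rightarrow> real"
  proof -
    have "g integrable_on {a..s'}"
      using that by (intro integrable_on_subinterval[OF that(1)]) auto
    then show ?thesis
      using Henstock_Kurzweil_Integration.integral_combine[of a s s' g] that by simp
  qed
  have z_mono: "z s \<le> z s'" if "a \<le> s" "s \<le> s'" "s' \<le> c" for s s'
  proof -
    have "0 \<le> integral {s..s'} (\<lambda>x. l x * y x)"
      by (intro integral_nonneg integrable_on_subinterval[OF ly_int] mult_nonneg_nonneg l_nonneg y_nonneg)
        (use that in auto)
    then show ?thesis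
      using split[OF ly_int that] by (simp add: z_def)
  qed
  have "z c \<le> z a * exp (integral {a..c} l - integral {a..a} l)"
  proof (rule Gronwall_increments[OF \<open>a \<le> c\<close>])
    show "continuous_on {a..c} (\<lambda>s. integral {a..s} l)"
      by (rule indefinite_integral_continuous_1[OF l_int])
    fix s s' assume s: "a \<le> s" "s \<le> s'" "s' \<le> c"
    have l_sub: "l integrable_on {s..s'}"
      by (rule integrable_on_subinterval[OF l_int]) (use s in auto)
    have "0 \<le> integral {s..s'} l"
      by (intro integral_nonneg l_sub l_nonneg) (use s in auto)
    then show "integral {a..s} l \<le> integral {a..s'} l"
      using split[OF l_int s] by simp
    have "z s' - z s = integral {s..s'} (\<lambda>x. l x * y x)"
      using split[OF ly_int s] by (simp add: z_def)
    also have "\<dots> \<le> integral {s..s'} (\<lambda>x. z s' * l x)"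
    proof (rule integral_le)
      show "(\<lambda>x. l x * y x) integrable_on {s..s'}"
        by (rule integrable_on_subinterval[OF ly_int]) (use s in auto)
      show "(\<lambda>x. z s' * l x) integrable_on {s..s'}"
        using integrable_on_cmult_left[OF l_sub, of "z s'"] by simp
      fix x assume x: "x \<in> {s..s'}"
      then have "y x \<le> z s'"
        using le[of x] z_mono[of x s'] s by (auto simp: z_def)
      then show "l x * y x \<le> z s' * l x"
        using l_nonneg[of x] x s by (subst mult.commute, intro mult_right_mono) auto
    qed
    also have "\<dots> = z s' * (integral {a..s'} l - integral {a..s} l)"
      using split[OF l_int s] by simp
    finally show "z s' - z s \<le> z s' * (integral {a..s'} l - integral {a..s} l)" .
  qed
  moreover have "y c \<le> z c"
    using le[of c] \<open>a \<le> c\<close> by (simp add: z_def)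
  ultimately show ?thesis
    by (simp add: z_def)
qed

section \<open>Bochner integrals over intervals and polynomials\<close>

lemma Bochner_integral_split:
  fixes f :: "real \<Rightarrow> 'a::{real_inner, complete_space}"
  assumes "a \<le> b" "b \<le> c" and f: "Bochner_integrable (lebesgue_on {a..c}) f"
  shows "Bochner_integral (lebesgue_on {a..c}) f =
    Bochner_integral (lebesgue_on {a..b}) f + Bochner_integral (lebesgue_on {b..c}) f"
proof -
  have complete: "complete_measure (lebesgue_on {x..y})" for x y :: real
    by (rule complete_measure_lebesgue_on) simp
  have f': "Bochner_integrable (lebesgue_on {x..y}) f" if "{x..y} \<subseteq> {a..c}" for x y
    using f that unfolding Bochner_integrable_iff[OF complete]
    by (blast intro: strongly_measurable_restrict integrable_subinterval)
  have inner: "inner (Bochner_integral (lebesgue_on {x..y}) f) v = integral {x..y} (\<lambda>s. inner (f s) v)"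
    if "{x..y} \<subseteq> {a..c}" for x y v
    using inner_Bochner_integral[OF complete f'[OF that]]
      lebesgue_integral_eq_integral[OF integrable_inner_Bochner[OF complete f'[OF that]]] by simp
  have "inner (Bochner_integral (lebesgue_on {a..c}) f) v =
    inner (Bochner_integral (lebesgue_on {a..b}) f + Bochner_integral (lebesgue_on {b..c}) f) v" for v
  proof -
    have "(\<lambda>s. inner (f s) v) integrable_on {a..c}"
      by (intro integrable_on_lebesgue_on integrable_inner_Bochner complete f) simp
    from Henstock_Kurzweil_Integration.integral_combine[OF assms(1,2) this]
    show ?thesis
      using assms(1,2) by (simp add: inner_add_left inner)
  qed
  then show ?thesis
    by (metis vector_eq_rdot)
qed

text \<open>Strong measurability is the superposition lemma for the field
  \<open>\<lambda>_ v. v\<close>, so no separability of the space enters.\<close>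

lemma continuous_on_imp_Bochner_integrable:
  fixes p :: "real \<Rightarrow> 'a::{real_normed_vector, complete_space}"
  assumes p: "continuous_on {a..b} p"
  shows "Bochner_integrable (lebesgue_on {a..b}) p"
proof -
  have "strongly_measurable (lebesgue_on {a..b}) p"
  proof (rule strongly_measurable_superposition[of a b "\<lambda>_ v. v", OF _ _ p])
    show "strongly_measurable (lebesgue_on {a..b}) (\<lambda>s. v)" for v :: 'a
      by (rule simple_function_strongly_measurable) simp
  qed (rule continuous_on_id)
  moreover have "integrable (lebesgue_on {a..b}) (\<lambda>s. norm (p s))"
    by (intro continuous_on_imp_integrable_lebesgue_on continuous_intros p)
  ultimately show ?thesis
    by (subst Bochner_integrable_iff) (auto intro: complete_measure_lebesgue_on)
qed

text \<open>Makes the reconstruction explicit: its continuity and its values in the discrete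
  subspace are read off \<open>q\<close>. The fundamental theorem of calculus is applied after
  testing with a vector.\<close>

lemma poly_space_antiderivative:
  fixes p :: "real \<Rightarrow> 'a::{real_inner, complete_space}"
  assumes S: "subspace S" and p: "p \<in> poly_space r S"
  obtains q where "continuous_on UNIV q" "\<And>s. q s \<in> S"
    "\<And>a b. a \<le> b \<Longrightarrow> Bochner_integral (lebesgue_on {a..b}) p = q b - q a"
proof -
  obtain c where c: "\<And>i. i \<le> r \<Longrightarrow> c i \<in> S" "p = (\<lambda>s. \<Sum>i\<le>r. s ^ i *\<^sub>R c i)"
    using p unfolding poly_space_def by blast
  define q where "q s = (\<Sum>i\<le>r. (s ^ Suc i / real (Suc i)) *\<^sub>R c i)" for s :: real
  have "continuous_on UNIV q"
    unfolding q_def by (intro continuous_intros) auto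
  moreover have "q s \<in> S" for s
    unfolding q_def by (intro subspace_sum[OF S] subspace_scale[OF S] c(1)) simp
  moreover have "Bochner_integral (lebesgue_on {a..b}) p = q b - q a" if "a \<le> b" for a b
  proof -
    have complete: "complete_measure (lebesgue_on {a..b})"
      by (rule complete_measure_lebesgue_on) simp
    note p_cont = continuous_on_poly_space[OF p, of "{a..b}"]
    have "inner (Bochner_integral (lebesgue_on {a..b}) p) v = inner (q b - q a) v" for v
    proof -
      have "inner (Bochner_integral (lebesgue_on {a..b}) p) v = (LINT s|lebesgue_on {a..b}. inner (p s) v)"
        by (rule inner_Bochner_integral[OF complete continuous_on_imp_Bochner_integrable[OF p_cont]])
      also have "\<dots> = integral {a..b} (\<lambda>s. inner (p s) v)"
        by (intro lebesgue_integral_eq_integral continuous_on_imp_integrable_lebesgue_on continuous_intros p_cont) simp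
      also have "\<dots> = inner (q b) v - inner (q a) v"
      proof (intro integral_unique fundamental_theorem_of_calculus \<open>a \<le> b\<close>)
        fix s
        have "((\<lambda>s. s ^ Suc i / real (Suc i) * inner (c i) v) has_real_derivative s ^ i * inner (c i) v) (at s)" for i
          by (auto intro!: derivative_eq_intros simp del: power_Suc)
        then have "((\<lambda>s. \<Sum>i\<le>r. s ^ Suc i / real (Suc i) * inner (c i) v) has_real_derivative
            (\<Sum>i\<le>r. s ^ i * inner (c i) v)) (at s)"
          by (rule DERIV_sum)
        then show "((\<lambda>s. inner (q s) v) has_vector_derivative inner (p s) v) (at s within {a..b})"
          by (simp add: q_def c(2) inner_sum_left has_real_derivative_iff_has_vector_derivative
              has_vector_derivative_at_within)
      qed
      finally show ?thesis
        by (simp add: inner_diff_left)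
    qed
    then show ?thesis
      by (metis vector_eq_rdot)
  qed
  ultimately show thesis
    by (rule that)
qed

lemma LINT_vector_derivative_poly_space:
  fixes p U :: "real \<Rightarrow> 'a::real_inner"
  assumes "a \<le> b" and p: "p \<in> poly_space r S" and U: "\<And>s. s \<in> {a<..<b} \<Longrightarrow> U s = p s"
  shows "(LINT s|lebesgue_on {a<..<b}. inner (vector_derivative U (at s)) v) = inner (p b - p a) v"
proof -
  obtain c where c: "p = (\<lambda>s. \<Sum>i\<le>r. s ^ i *\<^sub>R c i)"
    using p unfolding poly_space_def by blast
  \<comment> \<open>For \<open>i = 0\<close> the truncated exponent yields the factor 1, and
    \<open>real i\<close> removes the term.\<close>
  define p' where "p' s = (\<Sum>i\<le>r. (real i * s ^ (i - 1)) *\<^sub>R c i)" for s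
  have p': "(p has_vector_derivative p' s) (at s)" for s
    unfolding c p'_def has_vector_derivative_def
    by (auto intro!: derivative_eq_intros simp: scaleR_sum_right fun_eq_iff mult_ac)
  have "vector_derivative U (at s) = p' s" if s: "s \<in> {a<..<b}" for s
  proof -
    have "(U has_vector_derivative p' s) (at s)"
      using p' by (rule has_vector_derivative_transform_within_open[of _ _ _ "{a<..<b}"]) (use s U in auto)
    then show ?thesis
      by (rule vector_derivative_at)
  qed
  then have "(LINT s|lebesgue_on {a<..<b}. inner (vector_derivative U (at s)) v) =
      (LINT s|lebesgue_on {a<..<b}. inner (p' s) v)"
    by (intro Bochner_Integration.integral_cong) auto
  also have "\<dots> = (LINT s|lebesgue_on {a..b}. inner (p' s) v)"
    by (rule LINT_lebesgue_on_Ioo)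
  also have "\<dots> = integral {a..b} (\<lambda>s. inner (p' s) v)"
    unfolding p'_def
    by (intro lebesgue_integral_eq_integral continuous_on_imp_integrable_lebesgue_on continuous_intros) simp
  also have "\<dots> = inner (p b) v - inner (p a) v"
  proof (intro integral_unique fundamental_theorem_of_calculus \<open>a \<le> b\<close>)
    fix s
    show "((\<lambda>s. inner (p s) v) has_vector_derivative inner (p' s) v) (at s within {a..b})"
      using bounded_linear.has_vector_derivative[OF bounded_linear_inner_left p']
      by (rule has_vector_derivative_at_within)
  qed
  finally show ?thesis
    by (simp add: inner_diff_left)
qed

section \<open>The error bound on one interval\<close>

locale locally_Lipschitz_field =
  fixes F :: "real \<Rightarrow> 'a::{real_inner, complete_space} \<Rightarrow> 'a"
    and L :: "real \<Rightarrow> real \<Rightarrow> real \<Rightarrow> real" and T :: real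
  assumes F_meas: "strongly_measurable (lebesgue_on {0..T}) (\<lambda>s. F s v)"
    and F_zero: "Bochner_integrable (lebesgue_on {0<..<T}) (\<lambda>s. F s 0)"
    and F_lip: "s \<in> {0..T} \<Longrightarrow> norm (F s v - F s w) \<le> L s (norm v) (norm w) * norm (v - w)"
    and L_nonneg: "s \<in> {0..T} \<Longrightarrow> x \<ge> 0 \<Longrightarrow> y \<ge> 0 \<Longrightarrow> L s x y \<ge> 0"
    and L_int: "x \<ge> 0 \<Longrightarrow> y \<ge> 0 \<Longrightarrow> integrable (lebesgue_on {0<..<T}) (\<lambda>s. L s x y)"
    and L_cont2: "s \<in> {0..T} \<Longrightarrow> y \<ge> 0 \<Longrightarrow> continuous_on {0..} (\<lambda>x. L s x y)"
    and L_cont3: "s \<in> {0..T} \<Longrightarrow> x \<ge> 0 \<Longrightarrow> continuous_on {0..} (\<lambda>y. L s x y)"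
    and L_mono2: "s \<in> {0..T} \<Longrightarrow> y \<ge> 0 \<Longrightarrow> mono_on {0..} (\<lambda>x. L s x y)"
    and L_mono3: "s \<in> {0..T} \<Longrightarrow> x \<ge> 0 \<Longrightarrow> mono_on {0..} (\<lambda>y. L s x y)"
begin

lemma L_mono:
  assumes "s \<in> {0..T}" "0 \<le> x" "x \<le> x'" "0 \<le> y" "y \<le> y'"
  shows "L s x y \<le> L s x' y'"
proof -
  have "L s x y \<le> L s x' y"
    using assms by (intro mono_onD[OF L_mono2]) auto
  also have "\<dots> \<le> L s x' y'"
    using assms by (intro mono_onD[OF L_mono3]) auto
  finally show ?thesis .
qed

text \<open>Vectors within distance 1 of \<open>v\<close> have norm at most
  \<open>norm v + 1\<close>, so by monotonicity of \<open>L\<close> the constant \<open>?K\<close>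
  is a Lipschitz bound near \<open>v\<close>.\<close>

lemma F_continuous:
  assumes s: "s \<in> {0..T}"
  shows "continuous_on UNIV (F s)"
proof (rule continuous_at_imp_continuous_on, rule ballI)
  fix v :: 'a
  let ?K = "L s (norm v + 1) (norm v + 1)"
  have "((\<lambda>w. F s w - F s v) \<longlongrightarrow> 0) (at v)"
  proof (rule Lim_null_comparison)
    show "eventually (\<lambda>w. norm (F s w - F s v) \<le> ?K * norm (w - v)) (at v)"
      unfolding eventually_at
    proof (intro exI[of _ 1] conjI ballI impI)
      fix w assume "w \<noteq> v \<and> dist w v < 1"
      then have "norm w \<le> norm v + 1"
        using norm_triangle_sub[of w v] by (simp add: dist_norm)
      then have "L s (norm w) (norm v) \<le> ?K"
        using s by (intro L_mono) auto
      then have "L s (norm w) (norm v) * norm (w - v) \<le> ?K * norm (w - v)"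
        by (intro mult_right_mono) auto
      then show "norm (F s w - F s v) \<le> ?K * norm (w - v)"
        using F_lip[OF s, of w v] by simp
    qed simp
    show "((\<lambda>w. ?K * norm (w - v)) \<longlongrightarrow> 0) (at v)"
      by (auto intro!: tendsto_eq_intros)
  qed
  then show "isCont (F s) v"
    unfolding isCont_def by (rule LIM_zero_cancel)
qed

lemma L_integrable_Icc:
  assumes "x \<ge> 0" "y \<ge> 0" "{a..b} \<subseteq> {0..T}"
  shows "integrable (lebesgue_on {a..b}) (\<lambda>s. L s x y)"
  using L_int[OF assms(1,2)] assms(3) unfolding integrable_lebesgue_on_Ioo_iff
  by (rule integrable_subinterval)

text \<open>Continuity of \<open>L\<close> is available in each argument separately, so the
  superposition lemma is applied twice, inserting first \<open>q\<close> and then \<open>p\<close>.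
  Monotonicity dominates the result by \<open>L\<close> at constant bounds of \<open>p\<close> and
  \<open>q\<close>.\<close>

lemma L_superposition_integrable:
  assumes sub: "{a..b} \<subseteq> {0..T}"
    and p: "continuous_on {a..b} p" "\<And>s. s \<in> {a..b} \<Longrightarrow> p s \<ge> 0"
    and q: "continuous_on {a..b} q" "\<And>s. s \<in> {a..b} \<Longrightarrow> q s \<ge> 0"
  shows "integrable (lebesgue_on {a..b}) (\<lambda>s. L s (p s) (q s))"
proof -
  have "compact (p ` {a..b})" "compact (q ` {a..b})"
    using p q by (auto intro!: compact_continuous_image)
  then have "bounded (p ` {a..b})" "bounded (q ` {a..b})"
    by (auto intro: compact_imp_bounded)
  then obtain P Q where "\<forall>x\<in>p ` {a..b}. norm x \<le> P" "\<forall>x\<in>q ` {a..b}. norm x \<le> Q"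
    unfolding bounded_iff by blast
  then have PQ: "\<And>s. s \<in> {a..b} \<Longrightarrow> p s \<le> \<bar>P\<bar>" "\<And>s. s \<in> {a..b} \<Longrightarrow> q s \<le> \<bar>Q\<bar>"
    by (force simp: abs_le_iff)+
  \<comment> \<open>The maxima with 0 extend \<open>L\<close> continuously from non-negative
    arguments to the whole line, as the superposition lemma demands; along \<open>p\<close> and
    \<open>q\<close> they change nothing.\<close>
  have "strongly_measurable (lebesgue_on {a..b}) (\<lambda>s. L s (max 0 x) (max 0 (q s)))" for x
  proof (rule strongly_measurable_superposition[OF _ _ q(1)])
    show "strongly_measurable (lebesgue_on {a..b}) (\<lambda>s. L s (max 0 x) (max 0 v))" for v
      by (intro borel_measurable_imp_strongly_measurable borel_measurable_integrable
          L_integrable_Icc sub) auto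
    show "continuous_on UNIV (\<lambda>v. L s (max 0 x) (max 0 v))" if "s \<in> {a..b}" for s
      by (rule continuous_on_compose2[OF L_cont3, of s "max 0 x"]) (use that sub in \<open>auto intro!: continuous_intros\<close>)
  qed
  then have "strongly_measurable (lebesgue_on {a..b}) (\<lambda>s. L s (max 0 (p s)) (max 0 (q s)))"
  proof (rule strongly_measurable_superposition[OF _ _ p(1)])
    show "continuous_on UNIV (\<lambda>v. L s (max 0 v) (max 0 (q s)))" if "s \<in> {a..b}" for s
      by (rule continuous_on_compose2[OF L_cont2, of s "max 0 (q s)"]) (use that sub in \<open>auto intro!: continuous_intros\<close>)
  qed
  then have meas: "(\<lambda>s. L s (max 0 (p s)) (max 0 (q s))) \<in> borel_measurable (lebesgue_on {a..b})"
    by (intro strongly_measurable_imp_borel_measurable complete_measure_lebesgue_on) auto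
  have "integrable (lebesgue_on {a..b}) (\<lambda>s. L s (max 0 (p s)) (max 0 (q s)))"
  proof (rule Bochner_Integration.integrable_bound[OF _ meas])
    show "integrable (lebesgue_on {a..b}) (\<lambda>s. L s \<bar>P\<bar> \<bar>Q\<bar>)"
      by (intro L_integrable_Icc sub) auto
    show "AE s in lebesgue_on {a..b}. norm (L s (max 0 (p s)) (max 0 (q s))) \<le> norm (L s \<bar>P\<bar> \<bar>Q\<bar>)"
    proof (rule AE_I2)
      fix s assume "s \<in> space (lebesgue_on {a..b})"
      then have s: "s \<in> {a..b}" "s \<in> {0..T}"
        using sub by auto
      have "0 \<le> L s (max 0 (p s)) (max 0 (q s))"
        using s by (intro L_nonneg) auto
      moreover have "L s (max 0 (p s)) (max 0 (q s)) \<le> L s \<bar>P\<bar> \<bar>Q\<bar>"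
        using s PQ by (intro L_mono) auto
      ultimately show "norm (L s (max 0 (p s)) (max 0 (q s))) \<le> norm (L s \<bar>P\<bar> \<bar>Q\<bar>)"
        by simp
    qed
  qed
  also have "?this \<longleftrightarrow> ?thesis"
    using p(2) q(2) by (intro Bochner_Integration.integrable_cong) auto
  finally show ?thesis .
qed

text \<open>The norm is dominated by comparing with the zero vector: the Lipschitz condition bounds
  \<open>F s (w s) - F s 0\<close> by \<open>L s (norm (w s)) 0 * norm (w s)\<close>.\<close>

lemma F_superposition_Bochner_integrable:
  assumes sub: "{a..b} \<subseteq> {0..T}" and w: "continuous_on {a..b} w"
  shows "Bochner_integrable (lebesgue_on {a..b}) (\<lambda>s. F s (w s))"
proof -
  have complete: "complete_measure (lebesgue_on {x..y})" "complete_measure (lebesgue_on {x<..<y})" for x y :: real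
    by (rule complete_measure_lebesgue_on, simp)+
  have sm: "strongly_measurable (lebesgue_on {a..b}) (\<lambda>s. F s (w s))"
  proof (rule strongly_measurable_superposition[OF _ _ w])
    show "strongly_measurable (lebesgue_on {a..b}) (\<lambda>s. F s v)" for v
      by (rule strongly_measurable_restrict[OF F_meas sub])
    show "continuous_on UNIV (F s)" if "s \<in> {a..b}" for s
      using that sub by (intro F_continuous) auto
  qed
  have F0: "integrable (lebesgue_on {a..b}) (\<lambda>s. norm (F s 0))"
    using F_zero sub integrable_subinterval
    unfolding Bochner_integrable_iff[OF complete(2)] integrable_lebesgue_on_Ioo_iff by blast
  have L0: "integrable (lebesgue_on {a..b}) (\<lambda>s. norm (w s) * L s (norm (w s)) (norm (0::'a)))"
    by (intro integrable_lebesgue_on_continuous_mult L_superposition_integrable sub continuous_intros w) auto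
  have "integrable (lebesgue_on {a..b}) (\<lambda>s. norm (F s (w s)))"
  proof (rule Bochner_Integration.integrable_bound[OF Bochner_Integration.integrable_add[OF F0 L0]])
    show "(\<lambda>s. norm (F s (w s))) \<in> borel_measurable (lebesgue_on {a..b})"
      by (rule borel_measurable_norm_strongly_measurable[OF complete(1) sm])
    show "AE s in lebesgue_on {a..b}. norm (norm (F s (w s))) \<le>
        norm (norm (F s 0) + norm (w s) * L s (norm (w s)) (norm (0::'a)))"
    proof (rule AE_I2)
      fix s assume "s \<in> space (lebesgue_on {a..b})"
      then have s: "s \<in> {0..T}"
        using sub by auto
      have "norm (F s (w s)) \<le> norm (F s 0) + norm (F s (w s) - F s 0)"
        by (rule norm_triangle_sub)
      also have "\<dots> \<le> norm (F s 0) + norm (w s) * L s (norm (w s)) (norm (0::'a))"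
        using F_lip[OF s, of "w s" 0] by (simp add: mult.commute)
      finally show "norm (norm (F s (w s))) \<le>
          norm (norm (F s 0) + norm (w s) * L s (norm (w s)) (norm (0::'a)))"
        by simp
    qed
  qed
  with sm show ?thesis
    unfolding Bochner_integrable_iff[OF complete(1)] by simp
qed

text \<open>By monotonicity \<open>norm (u x)\<close> in the coefficient may be replaced by any
  continuous majorant \<open>A\<close>. It is used with \<open>norm (u x)\<close> itself, and with
  \<open>\<delta> * \<psi> + norm (W x)\<close>, which turns the coefficient into that of
  \<open>phi\<close>.\<close>

lemma Gronwall_error_bound:
  assumes sub: "{a..c} \<subseteq> {0..T}" and "a \<le> c"
    and u: "continuous_on {a..c} u" and W: "continuous_on {a..c} W" and A: "continuous_on {a..c} A"
    and uA: "\<And>x. x \<in> {a..c} \<Longrightarrow> norm (u x) \<le> A x"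
    and le: "\<And>s. s \<in> {a..c} \<Longrightarrow> norm (u s - W s) \<le>
      \<psi> + integral {a..s} (\<lambda>x. L x (norm (u x)) (norm (W x)) * norm (u x - W x))"
  shows "norm (u c - W c) \<le> \<psi> * exp (integral {a..c} (\<lambda>x. L x (A x) (norm (W x))))"
proof (rule Gronwall_integral[OF \<open>a \<le> c\<close>])
  have A_nonneg: "0 \<le> A x" if "x \<in> {a..c}" for x
    using uA[OF that] norm_ge_zero order_trans by blast
  show int: "integrable (lebesgue_on {a..c}) (\<lambda>x. L x (A x) (norm (W x)))"
    using A_nonneg by (intro L_superposition_integrable sub A continuous_intros W) auto
  show "0 \<le> L s (A s) (norm (W s))" if "s \<in> {a..c}" for s
    using that sub A_nonneg by (intro L_nonneg) auto
  show "continuous_on {a..c} (\<lambda>s. norm (u s - W s))"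
    by (intro continuous_intros u W)
  fix s assume s: "s \<in> {a..c}"
  have sub': "{a..s} \<subseteq> {a..c}"
    using s by auto
  have "integral {a..s} (\<lambda>x. L x (norm (u x)) (norm (W x)) * norm (u x - W x))
      \<le> integral {a..s} (\<lambda>x. L x (A x) (norm (W x)) * norm (u x - W x))"
  proof (rule integral_le)
    have "integrable (lebesgue_on {a..c}) (\<lambda>x. norm (u x - W x) * L x (norm (u x)) (norm (W x)))"
      by (intro integrable_lebesgue_on_continuous_mult L_superposition_integrable sub continuous_intros u W) auto
    then show "(\<lambda>x. L x (norm (u x)) (norm (W x)) * norm (u x - W x)) integrable_on {a..s}"
      unfolding mult.commute[of "norm (u _ - W _)"]
      by (intro integrable_on_lebesgue_on integrable_subinterval[OF _ sub']) auto
    have "integrable (lebesgue_on {a..c}) (\<lambda>x. norm (u x - W x) * L x (A x) (norm (W x)))"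
      by (intro integrable_lebesgue_on_continuous_mult int continuous_intros u W)
    then show "(\<lambda>x. L x (A x) (norm (W x)) * norm (u x - W x)) integrable_on {a..s}"
      unfolding mult.commute[of "norm (u _ - W _)"]
      by (intro integrable_on_lebesgue_on integrable_subinterval[OF _ sub']) auto
    fix x assume "x \<in> {a..s}"
    then have x: "x \<in> {a..c}" "x \<in> {0..T}"
      using sub sub' by auto
    show "L x (norm (u x)) (norm (W x)) * norm (u x - W x) \<le> L x (A x) (norm (W x)) * norm (u x - W x)"
      using x uA by (intro mult_right_mono L_mono) auto
  qed
  with le[OF s] show "norm (u s - W s) \<le> \<psi> + integral {a..s} (\<lambda>x. L x (A x) (norm (W x)) * norm (u x - W x))"
    by simp
qed simp

text \<open>If the bound failed, the error would reach \<open>\<delta> * \<psi>\<close> at a first time \<open>c\<close>; up to \<open>c\<close> the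
  Lipschitz coefficient is the one in \<open>phi\<close>, so Gronwall gives an error below \<open>\<delta> * \<psi>\<close> at \<open>c\<close>.
  For \<open>\<psi> = 0\<close> the contradiction is not strict, but then Gronwall with any bound on \<open>u\<close> gives \<open>0\<close>.\<close>

lemma error_le_delta_set:
  assumes sub: "{a..b} \<subseteq> {0..T}"
    and u: "continuous_on {a..b} u" and W: "continuous_on {a..b} W"
    and le: "\<And>s. s \<in> {a..b} \<Longrightarrow> norm (u s - W s) \<le>
      \<psi> + integral {a..s} (\<lambda>x. L x (norm (u x)) (norm (W x)) * norm (u x - W x))"
    and \<delta>: "\<delta> \<in> delta_set L {a<..<b} \<psi> W" and s: "s \<in> {a..b}"
  shows "norm (u s - W s) \<le> \<delta> * \<psi>"
proof (rule ccontr)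
  assume s_gt: "\<not> norm (u s - W s) \<le> \<delta> * \<psi>"
  define e where "e x = norm (u x - W x)" for x
  have e: "continuous_on {a..b} e"
    unfolding e_def by (intro continuous_intros u W)
  have Gronwall: "e c \<le> \<psi> * exp (integral {a..c} (\<lambda>x. L x (A x) (norm (W x))))"
    if "c \<in> {a..b}" "continuous_on {a..b} A" "\<And>x. x \<in> {a..c} \<Longrightarrow> norm (u x) \<le> A x" for c A
  proof -
    have c: "{a..c} \<subseteq> {a..b}" "a \<le> c"
      using that(1) by auto
    show ?thesis
      unfolding e_def
      using Gronwall_error_bound[OF _ c(2) continuous_on_subset[OF u c(1)] continuous_on_subset[OF W c(1)]
          continuous_on_subset[OF that(2) c(1)] that(3) le] c sub by auto
  qed
  have "e a \<le> \<psi>"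
    using le[of a] s by (simp add: e_def)
  then have "\<psi> \<ge> 0"
    by (metis e_def norm_ge_zero order_trans)
  have "\<delta> > 1"
    using \<delta> by (simp add: delta_set_def)
  show False
  proof (cases "\<psi> = 0")
    case True
    have "e s \<le> \<psi> * exp (integral {a..s} (\<lambda>x. L x (norm (u x)) (norm (W x))))"
      by (intro Gronwall s continuous_intros u) simp
    with True s_gt show False
      by (simp add: e_def)
  next
    case False
    with \<open>\<psi> \<ge> 0\<close> have "\<psi> > 0"
      by simp
    with \<open>\<delta> > 1\<close> have "\<psi> < \<delta> * \<psi>"
      by simp
    with \<open>e a \<le> \<psi>\<close> have e_a: "e a \<le> \<delta> * \<psi>"
      by simp
    \<comment> \<open>Exceeding the threshold forces an earlier exact hit. This makes the compact
      set \<open>Z\<close> of hitting times nonempty, and it later excludes larger errors before its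
      minimum \<open>c\<close>.\<close>
    have hit: "\<exists>x\<in>{a..y}. e x = \<delta> * \<psi>" if "y \<in> {a..b}" "e y > \<delta> * \<psi>" for y
    proof -
      have "continuous_on {a..y} e"
        by (rule continuous_on_subset[OF e]) (use that in auto)
      then show ?thesis
        using IVT'[of e a "\<delta> * \<psi>" y] that e_a by auto
    qed
    define Z where "Z = {x \<in> {a..b}. e x = \<delta> * \<psi>}"
    have "closed Z"
      unfolding Z_def by (rule continuous_closed_preimage_constant[OF e closed_atLeastAtMost])
    moreover have "bounded Z"
      by (rule bounded_subset[of "{a..b}"]) (auto simp: Z_def)
    ultimately have "compact Z"
      by (simp add: compact_eq_bounded_closed)
    moreover have "Z \<noteq> {}"
    proof -
      have "e s > \<delta> * \<psi>"
        using s_gt by (simp add: e_def)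
      from hit[OF s this] obtain x where "x \<in> {a..s}" "e x = \<delta> * \<psi>"
        by blast
      with s have "x \<in> Z"
        by (simp add: Z_def)
      then show ?thesis
        by blast
    qed
    ultimately obtain c where c: "c \<in> Z" "\<And>x. x \<in> Z \<Longrightarrow> c \<le> x"
      using compact_attains_inf[of Z] by blast
    have le_c: "e x \<le> \<delta> * \<psi>" if "x \<in> {a..c}" for x
    proof (rule ccontr)
      assume *: "\<not> e x \<le> \<delta> * \<psi>"
      moreover have "x \<in> {a..b}"
        using that c(1) by (auto simp: Z_def)
      ultimately obtain y where y: "y \<in> {a..x}" "e y = \<delta> * \<psi>"
        using hit[of x] by auto
      then have "y \<in> Z"
        using \<open>x \<in> {a..b}\<close> by (auto simp: Z_def)
      then have "y = x"
        using c(2)[of y] y(1) that by simp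
      with y(2) * show False
        by simp
    qed
    let ?l = "\<lambda>x. L x (\<delta> * \<psi> + norm (W x)) (norm (W x))"
    have nonneg: "0 \<le> \<delta> * \<psi> + norm (W x)" for x
      using \<open>\<delta> > 1\<close> \<open>\<psi> \<ge> 0\<close> by simp
    have int: "integrable (lebesgue_on {a..b}) ?l"
      using nonneg by (intro L_superposition_integrable sub continuous_intros W) auto
    have c_mem: "c \<in> {a..b}"
      using c(1) by (simp add: Z_def)
    have "\<delta> * \<psi> \<le> \<psi> * exp (integral {a..c} ?l)"
    proof -
      have "norm (u x) \<le> \<delta> * \<psi> + norm (W x)" if "x \<in> {a..c}" for x
        using le_c[OF that] norm_triangle_sub[of "u x" "W x"] by (simp add: e_def)
      then have "e c \<le> \<psi> * exp (integral {a..c} ?l)"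
        by (intro Gronwall c_mem continuous_intros W) auto
      then show ?thesis
        using c(1) by (simp add: Z_def)
    qed
    \<comment> \<open>The coefficient is non-negative, so extending the integral from
      \<open>c\<close> to \<open>b\<close>, the interval of \<open>phi\<close>, can only increase
      it.\<close>
    also have "\<dots> \<le> \<psi> * exp (integral {a..b} ?l)"
    proof -
      have "?l integrable_on {a..b}"
        by (intro integrable_on_lebesgue_on int) simp
      then have "integral {a..c} ?l \<le> integral {a..b} ?l"
        using c_mem sub nonneg
        by (intro integral_subset_le integrable_on_subinterval[of _ "{a..b}" a c] ballI L_nonneg) auto
      then show ?thesis
        using \<open>\<psi> > 0\<close> by simp
    qed
    also have "exp (integral {a..b} ?l) < \<delta>"
      using \<delta> lebesgue_integral_eq_integral[OF int]
      by (simp add: delta_set_def phi_def LINT_lebesgue_on_Ioo)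
    finally show False
      using \<open>\<psi> > 0\<close> by (simp add: mult.commute)
  qed
qed

text \<open>The error is the initial error plus the residual of \<open>W\<close> plus
  \<open>d\<close>, the difference of the two integrals. Testing \<open>d\<close> with itself gives
  \<open>norm d * norm d\<close> at most \<open>norm d\<close> times the integral of the Lipschitz
  bound, which stands in for a norm inequality for Bochner integrals.\<close>

lemma error_equation_bound:
  assumes sub: "{a..b} \<subseteq> {0..T}" and s: "s \<in> {a..b}"
    and u: "continuous_on {a..b} u" and W: "continuous_on {a..b} W"
    and u_sol: "u s = u a + Bochner_integral (lebesgue_on {a..s}) (\<lambda>x. F x (u x))"
  shows "norm (u s - W s) \<le> norm (u a - W a)
    + norm (W a - W s + Bochner_integral (lebesgue_on {a..s}) (\<lambda>x. F x (W x)))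
    + integral {a..s} (\<lambda>x. L x (norm (u x)) (norm (W x)) * norm (u x - W x))"
proof -
  have sub': "{a..s} \<subseteq> {a..b}"
    using s by auto
  note cont = continuous_on_subset[OF u sub'] continuous_on_subset[OF W sub']
  have sub0: "{a..s} \<subseteq> {0..T}"
    using sub sub' by blast
  have complete: "complete_measure (lebesgue_on {a..s})"
    by (rule complete_measure_lebesgue_on) simp
  note int = F_superposition_Bochner_integrable[OF sub0 cont(1)] F_superposition_Bochner_integrable[OF sub0 cont(2)]
  define d where "d = Bochner_integral (lebesgue_on {a..s}) (\<lambda>x. F x (u x))
    - Bochner_integral (lebesgue_on {a..s}) (\<lambda>x. F x (W x))"
  let ?g = "\<lambda>x. L x (norm (u x)) (norm (W x)) * norm (u x - W x)"
  have "integrable (lebesgue_on {a..s}) (\<lambda>x. norm (u x - W x) * L x (norm (u x)) (norm (W x)))"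
    by (intro integrable_lebesgue_on_continuous_mult L_superposition_integrable sub0 continuous_intros cont) auto
  then have g: "integrable (lebesgue_on {a..s}) ?g"
    by (simp add: mult.commute)
  have g_eq: "(LINT x|lebesgue_on {a..s}. ?g x) = integral {a..s} ?g"
    by (rule lebesgue_integral_eq_integral[OF g]) simp
  have "norm d * norm d = inner d d"
    by (simp add: norm_eq_sqrt_inner)
  also have "\<dots> = (LINT x|lebesgue_on {a..s}. inner (F x (u x)) d) - (LINT x|lebesgue_on {a..s}. inner (F x (W x)) d)"
    unfolding d_def inner_diff_left by (simp only: inner_Bochner_integral[OF complete int(1)]
        inner_Bochner_integral[OF complete int(2)])
  also have "\<dots> = (LINT x|lebesgue_on {a..s}. inner (F x (u x)) d - inner (F x (W x)) d)"
    by (rule Bochner_Integration.integral_diff[symmetric]) (intro integrable_inner_Bochner complete int)+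
  also have "\<dots> \<le> (LINT x|lebesgue_on {a..s}. norm d * ?g x)"
  proof (rule integral_mono)
    show "integrable (lebesgue_on {a..s}) (\<lambda>x. inner (F x (u x)) d - inner (F x (W x)) d)"
      by (intro Bochner_Integration.integrable_diff integrable_inner_Bochner complete int)
    show "integrable (lebesgue_on {a..s}) (\<lambda>x. norm d * ?g x)"
      using g by (rule integrable_mult_right)
    fix x assume "x \<in> space (lebesgue_on {a..s})"
    then have x: "x \<in> {0..T}"
      using sub0 by auto
    have "inner (F x (u x)) d - inner (F x (W x)) d = inner (F x (u x) - F x (W x)) d"
      by (simp add: inner_diff_left)
    also have "\<dots> \<le> norm (F x (u x) - F x (W x)) * norm d"
      by (rule norm_cauchy_schwarz)
    also have "\<dots> \<le> ?g x * norm d"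
      by (intro mult_right_mono F_lip x) simp
    finally show "inner (F x (u x)) d - inner (F x (W x)) d \<le> norm d * ?g x"
      by (simp add: mult.commute)
  qed
  also have "\<dots> = norm d * integral {a..s} ?g"
    by (simp add: g_eq)
  finally have "norm d * norm d \<le> norm d * integral {a..s} ?g" .
  moreover have "0 \<le> integral {a..s} ?g"
    by (intro integral_nonneg integrable_on_lebesgue_on g mult_nonneg_nonneg L_nonneg) (use sub0 in auto)
  \<comment> \<open>Cancelling \<open>norm d\<close> requires it to be nonzero; for
    \<open>d = 0\<close> the non-negativity of the integral suffices.\<close>
  ultimately have d_le: "norm d \<le> integral {a..s} ?g"
    by (cases "d = 0") auto
  have "u s - W s = (u a - W a) + (W a - W s + Bochner_integral (lebesgue_on {a..s}) (\<lambda>x. F x (W x))) + d"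
    using u_sol by (simp add: d_def)
  then have "norm (u s - W s) \<le> norm (u a - W a)
    + norm (W a - W s + Bochner_integral (lebesgue_on {a..s}) (\<lambda>x. F x (W x))) + norm d"
    by (metis norm_triangle_ineq norm_triangle_le add_right_mono)
  with d_le show ?thesis
    by simp
qed

end

text \<open>If the inequality failed at \<open>s\<close>, continuity of \<open>e\<close> and
  \<open>J x \<le> J s\<close> for \<open>x\<close> to the left of \<open>s\<close> would make it
  fail on a whole left neighbourhood, which is not negligible. The point \<open>a\<close> has no
  such neighbourhood and is excluded.\<close>

lemma AE_le_imp_le_left_continuous:
  fixes e J :: "real \<Rightarrow> real"
  assumes AE: "AE s in lebesgue_on {a<..<b}. e s \<le> J s"
    and e: "continuous_on {a..b} e"
    and J: "\<And>x y. a \<le> x \<Longrightarrow> x \<le> y \<Longrightarrow> y \<le> b \<Longrightarrow> J x \<le> J y"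
    and s: "a < s" "s \<le> b"
  shows "e s \<le> J s"
proof (rule ccontr)
  assume "\<not> e s \<le> J s"
  then have "0 < e s - J s" by simp
  moreover have "s \<in> {a..b}"
    using s by simp
  ultimately obtain d where d: "d > 0" "\<And>x. x \<in> {a..b} \<Longrightarrow> dist x s < d \<Longrightarrow> dist (e x) (e s) < e s - J s"
    using e unfolding continuous_on_iff by blast
  have "AE x in lebesgue. x \<in> {a<..<b} \<longrightarrow> e x \<le> J x"
    using AE by (subst (asm) AE_restrict_space_iff) auto
  then have "negligible {x. \<not> (x \<in> {a<..<b} \<longrightarrow> e x \<le> J x)}"
    by (simp add: completion.AE_iff_null_sets negligible_iff_null_sets)
  moreover have "{max a (s - d)<..<s} \<subseteq> {x. \<not> (x \<in> {a<..<b} \<longrightarrow> e x \<le> J x)}"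
  proof
    fix x assume x: "x \<in> {max a (s - d)<..<s}"
    then have "dist (e x) (e s) < e s - J s"
      using s by (intro d(2)) (auto simp: dist_real_def)
    then have "e x > J s"
      by (simp add: dist_real_def abs_less_iff)
    moreover have "J x \<le> J s"
      using x s by (intro J) auto
    ultimately show "x \<in> {x. \<not> (x \<in> {a<..<b} \<longrightarrow> e x \<le> J x)}"
      using x s by auto
  qed
  ultimately have "negligible {max a (s - d)<..<s}"
    by (rule negligible_subset)
  moreover have "\<not> negligible {max a (s - d)<..<s}"
    using d(1) s by (intro open_not_negligible open_greaterThanLessThan) auto
  ultimately show False
    by contradiction
qed

section \<open>The schemes and the reconstruction\<close>

lemma Lim_at_left_eq:
  fixes p U :: "real \<Rightarrow> 'a::t2_space"
  assumes "a < b" "continuous_on {a..b} p" "\<And>s. s \<in> {a<..<b} \<Longrightarrow> U s = p s"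
  shows "Lim (at_left b) U = p b"
proof (rule tendsto_Lim)
  have "(p \<longlongrightarrow> p b) (at_left b)"
    using assms(1,2) by (intro continuous_on_Icc_at_leftD) auto
  moreover have "eventually (\<lambda>s. p s = U s) (at_left b)"
    using assms(1,3) eventually_at_left_field by force
  ultimately show "(U \<longlongrightarrow> p b) (at_left b)"
    by (rule Lim_transform_eventually)
qed simp

lemma Lim_at_right_eq:
  fixes p U :: "real \<Rightarrow> 'a::t2_space"
  assumes "a < b" "continuous_on {a..b} p" "\<And>s. s \<in> {a<..<b} \<Longrightarrow> U s = p s"
  shows "Lim (at_right a) U = p a"
proof (rule tendsto_Lim)
  have "(p \<longlongrightarrow> p a) (at_right a)"
    using assms(1,2) by (intro continuous_on_Icc_at_rightD) auto
  moreover have "eventually (\<lambda>s. p s = U s) (at_right a)"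
    using assms(1,3) eventually_at_right_field by force
  ultimately show "(U \<longlongrightarrow> p a) (at_right a)"
    by (rule Lim_transform_eventually)
qed simp

lemma scheme_piecewise_poly:
  "hp_cG F u0 M t r Hs U \<or> hp_dG F u0 M t r Hs U \<Longrightarrow> piecewise_poly M t r Hs U"
  by (auto simp: hp_cG_def hp_dG_def)

text \<open>A constant \<open>v\<close> in \<open>Hs m\<close> is admissible in both schemes. In cG
  the start value is the projection of the preceding left value, and \<open>v\<close> cannot
  distinguish the two; in dG the jump term cancels the start value of the polynomial. Both leave the
  same identity.\<close>

lemma scheme_constant_test:
  fixes U :: "real \<Rightarrow> 'a::{real_inner, complete_space}"
  assumes scheme: "hp_cG F u0 M t r Hs U \<or> hp_dG F u0 M t r Hs U"
    and m: "m \<in> {1..M}" and less: "t (m - 1) < t m"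
    and B: "finite B" "Hs m = span B" and v: "v \<in> Hs m"
  shows "inner (left_value u0 t U m - left_value u0 t U (m - 1)) v =
    (LINT s|lebesgue_on (cell t m). inner (F s (U s)) v)"
proof -
  from scheme_piecewise_poly[OF scheme] m obtain p
    where p: "p \<in> poly_space (r m) (Hs m)" "\<And>s. s \<in> {t (m - 1)<..<t m} \<Longrightarrow> U s = p s"
    unfolding piecewise_poly_def cell_def by blast
  note p_cont = continuous_on_poly_space[OF p(1), of "{t (m - 1)..t m}"]
  have left: "left_value u0 t U m = p (t m)"
    using m Lim_at_left_eq[OF less p_cont p(2)] by (simp add: left_value_def)
  have right: "right_value t U (m - 1) = p (t (m - 1))"
    using Lim_at_right_eq[OF less p_cont p(2)] by (simp add: right_value_def)
  have deriv: "(LINT s|lebesgue_on (cell t m). inner (vector_derivative U (at s)) v) =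
      inner (p (t m) - p (t (m - 1))) v"
    unfolding cell_def by (rule LINT_vector_derivative_poly_space[OF _ p]) (use less in auto)
  have const: "(\<lambda>s. v) \<in> poly_space k (Hs m)" for k
    using v B(2) by (intro const_in_poly_space) (auto simp: subspace_span)
  show ?thesis
    using scheme
  proof
    assume cG: "hp_cG F u0 M t r Hs U"
    then have "\<forall>V\<in>poly_space (r m - 1) (Hs m).
        (LINT s|lebesgue_on (cell t m). inner (vector_derivative U (at s)) (V s)) =
        (LINT s|lebesgue_on (cell t m). inner (F s (U s)) (V s))"
      using m unfolding hp_cG_def by blast
    from bspec[OF this const]
    have "(LINT s|lebesgue_on (cell t m). inner (vector_derivative U (at s)) v) =
        (LINT s|lebesgue_on (cell t m). inner (F s (U s)) v)" .
    moreover have "p (t (m - 1)) = orth_proj (Hs m) (left_value u0 t U (m - 1))"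
      using cG m unfolding hp_cG_def right[symmetric] by blast
    then have "inner (p (t (m - 1))) v = inner (left_value u0 t U (m - 1)) v"
      using v B by (simp add: inner_orth_proj_span)
    ultimately show ?thesis
      using deriv by (simp add: left inner_diff_left)
  next
    assume "hp_dG F u0 M t r Hs U"
    then have "\<forall>V\<in>poly_space (r m) (Hs m).
        (LINT s|lebesgue_on (cell t m). inner (vector_derivative U (at s)) (V s)) +
        inner (right_value t U (m - 1) - left_value u0 t U (m - 1)) (V (t (m - 1))) =
        (LINT s|lebesgue_on (cell t m). inner (F s (U s)) (V s))"
      using m unfolding hp_dG_def by blast
    from bspec[OF this const, unfolded deriv right] show ?thesis
      by (simp add: left inner_diff_left)
  qed
qed

context locally_Lipschitz_field
begin

text \<open>Against constants from \<open>Hs m\<close> the L2 projection of the right-hand side is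
  invisible, and so is the projection of the start value. Hence \<open>Uhat\<close> and the scheme
  have the same end value when tested with \<open>Hs m\<close>.\<close>

lemma
  assumes scheme: "hp_cG F u0 M t r Hs U \<or> hp_dG F u0 M t r Hs U"
    and m: "m \<in> {1..M}" and less: "t (m - 1) < t m" and sub: "{t (m - 1)..t m} \<subseteq> {0..T}"
    and B: "finite B" "Hs m = span B"
  shows Uhat_continuous: "continuous_on {t (m - 1)..t m} (Uhat F u0 t r Hs U m)"
    and Uhat_start: "Uhat F u0 t r Hs U m (t (m - 1)) = orth_proj (Hs m) (left_value u0 t U (m - 1))"
    and Uhat_end: "Uhat F u0 t r Hs U m (t m) = left_value u0 t U m"
proof -
  let ?a = "t (m - 1)" and ?b = "t m" and ?W = "Uhat F u0 t r Hs U m"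
  let ?o = "orth_proj (Hs m) (left_value u0 t U (m - 1))"
  let ?P = "L2_proj (cell t m) (r m) (Hs m) (\<lambda>x. F x (U x))"
  from scheme_piecewise_poly[OF scheme] m obtain p
    where p: "p \<in> poly_space (r m) (Hs m)" "\<And>s. s \<in> {?a<..<?b} \<Longrightarrow> U s = p s"
    unfolding piecewise_poly_def cell_def by blast
  note p_cont = continuous_on_poly_space[OF p(1), of "{?a..?b}"]
  have f: "integrable (lebesgue_on {?a<..<?b}) (\<lambda>s. inner (F s (U s)) v)" for v
  proof -
    have "integrable (lebesgue_on {?a<..<?b}) (\<lambda>s. inner (F s (p s)) v)"
      unfolding integrable_lebesgue_on_Ioo_iff
      by (intro integrable_inner_Bochner complete_measure_lebesgue_on
          F_superposition_Bochner_integrable sub p_cont) simp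
    also have "?this \<longleftrightarrow> ?thesis"
      using p(2) by (intro Bochner_Integration.integrable_cong) auto
    finally show ?thesis .
  qed
  have S: "subspace (Hs m)"
    by (simp add: B(2) subspace_span)
  have P: "?P \<in> poly_space (r m) (Hs m)"
    unfolding cell_def B(2) by (rule L2_proj_in_poly_space[OF less B(1) f])
  from poly_space_antiderivative[OF S P] obtain q where q: "continuous_on UNIV q" "\<And>s. q s \<in> Hs m"
    "\<And>a b. a \<le> b \<Longrightarrow> Bochner_integral (lebesgue_on {a..b}) ?P = q b - q a" by blast
  have W: "?W s = ?o + (q s - q ?a)" if "?a \<le> s" for s
    unfolding Uhat_def q(3)[OF that] ..
  have "continuous_on {?a..?b} (\<lambda>s. ?o + (q s - q ?a))"
    by (intro continuous_intros continuous_on_subset[OF q(1)]) auto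
  then show "continuous_on {?a..?b} ?W"
    by (rule continuous_on_eq) (simp add: W)
  show "?W ?a = ?o"
    by (simp add: W)
  have "left_value u0 t U m = p ?b"
    using m Lim_at_left_eq[OF less p_cont p(2)] by (simp add: left_value_def)
  moreover have "p ?b \<in> Hs m"
    using p(1) S unfolding poly_space_def by (auto intro!: subspace_sum subspace_scale)
  moreover have "?o \<in> Hs m"
    unfolding B(2) by (rule orth_proj_in_span[OF B(1)])
  \<comment> \<open>Membership makes the difference itself a test vector; \<open>weak\<close> then
    shows that it is orthogonal to itself.\<close>
  ultimately have diff: "?W ?b - left_value u0 t U m \<in> Hs m"
    using less q(2) by (simp add: W S subspace_add subspace_diff)
  have weak: "inner (?W ?b) v = inner (left_value u0 t U m) v" if v: "v \<in> Hs m" for v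
  proof -
    have P_int: "integrable (lebesgue_on {?a<..<?b}) (\<lambda>s. inner (?P s) v)"
      unfolding integrable_lebesgue_on_Ioo_iff
      by (intro continuous_on_imp_integrable_lebesgue_on continuous_intros continuous_on_poly_space[OF P])
    have "inner (q ?b - q ?a) v = (LINT s|lebesgue_on {?a..?b}. inner (?P s) v)"
      using less by (subst q(3)[symmetric], simp, intro inner_Bochner_integral complete_measure_lebesgue_on
          continuous_on_imp_Bochner_integrable continuous_on_poly_space[OF P]) simp
    also have "\<dots> = (LINT s|lebesgue_on {?a<..<?b}. inner (?P s) v)"
      by (rule LINT_lebesgue_on_Ioo[symmetric])
    also have "\<dots> = (LINT s|lebesgue_on {?a<..<?b}. inner (F s (U s)) v)"
    proof -
      have "(LINT s|lebesgue_on {?a<..<?b}. inner (?P s - F s (U s)) v) = 0"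
        unfolding cell_def B(2)
        by (rule L2_proj_orthogonal[OF less B(1) f]) (use v B(2) const_in_poly_space[OF S] in simp)
      then show ?thesis
        unfolding inner_diff_left using Bochner_Integration.integral_diff[OF P_int f[of v]] by simp
    qed
    also have "\<dots> = inner (left_value u0 t U m - left_value u0 t U (m - 1)) v"
      using scheme_constant_test[OF scheme m less B v] by (simp add: cell_def)
    finally have "inner (q ?b - q ?a) v = inner (left_value u0 t U m - left_value u0 t U (m - 1)) v" .
    moreover have "inner ?o v = inner (left_value u0 t U (m - 1)) v"
      using v unfolding B(2) by (rule inner_orth_proj_span[OF B(1)])
    ultimately show ?thesis
      using less by (simp add: W inner_add_left inner_diff_left)
  qed
  from weak[OF diff] have "inner (?W ?b - left_value u0 t U m) (?W ?b - left_value u0 t U m) = 0"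
    by (simp add: inner_diff_left)
  then show "?W ?b = left_value u0 t U m"
    by simp
qed

end

section \<open>The error estimate for both schemes\<close>

lemma AE_norm_le_Linf_norm:
  "AE s in lebesgue_on I. ereal (norm (f s)) \<le> Linf_norm I f"
  unfolding Linf_norm_def by (rule esssup_AE)

theorem corollary3p29:
  fixes F :: "real \<Rightarrow> 'a::{real_inner,complete_space} \<Rightarrow> 'a"
    and L :: "real \<Rightarrow> real \<Rightarrow> real \<Rightarrow> real"
    and u U :: "real \<Rightarrow> 'a" and u0 :: 'a and T :: real
    and M m :: nat and t :: "nat \<Rightarrow> real" and r :: "nat \<Rightarrow> nat" and Hs :: "nat \<Rightarrow> 'a set"
    and \<psi> :: "nat \<Rightarrow> real"
  assumes "T > 0"
    and F_meas: "\<And>v. strongly_measurable (lebesgue_on {0..T}) (\<lambda>s. F s v)"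
    and F_zero: "Bochner_integrable (lebesgue_on {0<..<T}) (\<lambda>s. F s 0)"
    and F_lip: "\<And>s v w. s \<in> {0..T} \<Longrightarrow> norm (F s v - F s w) \<le> L s (norm v) (norm w) * norm (v - w)"
    and L_nonneg: "\<And>s a b. s \<in> {0..T} \<Longrightarrow> a \<ge> 0 \<Longrightarrow> b \<ge> 0 \<Longrightarrow> L s a b \<ge> 0"
    and L_int: "\<And>a b. a \<ge> 0 \<Longrightarrow> b \<ge> 0 \<Longrightarrow> integrable (lebesgue_on {0<..<T}) (\<lambda>s. L s a b)"
    and L_cont2: "\<And>s b. s \<in> {0..T} \<Longrightarrow> b \<ge> 0 \<Longrightarrow> continuous_on {0..} (\<lambda>a. L s a b)"
    and L_cont3: "\<And>s a. s \<in> {0..T} \<Longrightarrow> a \<ge> 0 \<Longrightarrow> continuous_on {0..} (\<lambda>b. L s a b)"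
    and L_mono2: "\<And>s b. s \<in> {0..T} \<Longrightarrow> b \<ge> 0 \<Longrightarrow> mono_on {0..} (\<lambda>a. L s a b)"
    and L_mono3: "\<And>s a. s \<in> {0..T} \<Longrightarrow> a \<ge> 0 \<Longrightarrow> mono_on {0..} (\<lambda>b. L s a b)"
    and u_cont: "continuous_on {0..T} u"
    and u_sol: "\<And>s. s \<in> {0..T} \<Longrightarrow> u s = u0 + Bochner_integral (lebesgue_on {0..s}) (\<lambda>x. F x (u x))"
    and t_first: "t 0 = 0" and t_last: "t M = T"
    and t_less: "\<And>i. i < M \<Longrightarrow> t i < t (Suc i)"
    and Hs_subspace: "\<And>i. i \<in> {1..M} \<Longrightarrow> subspace (Hs i)"
    and Hs_fin_dim: "\<And>i. i \<in> {1..M} \<Longrightarrow> \<exists>B. finite B \<and> Hs i = span B"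
    and U_scheme: "hp_cG F u0 M t r Hs U \<or> hp_dG F u0 M t r Hs U"
    and psi_first: "ereal (\<psi> 1) \<ge> ereal (eta_proj u0 t Hs U 0) + eta_res F u0 t r Hs U 1"
    and psi_later: "\<And>i. i \<in> {2..M} \<Longrightarrow>
      ereal (\<psi> i) \<ge> ereal (norm (u (t (i - 1)) - Uhat F u0 t r Hs U (i - 1) (t (i - 1))))
        + ereal (eta_proj u0 t Hs U (i - 1)) + eta_res F u0 t r Hs U i"
    and m: "1 \<le> m" "m \<le> M"
    and delta_exists: "\<And>i. i \<in> {1..m} \<Longrightarrow>
      delta_set L (cell t i) (\<psi> i) (Uhat F u0 t r Hs U i) \<noteq> {}"
  shows "Linf_norm (cell t m) (\<lambda>s. u s - U s)
    \<le> ereal (delta L (cell t m) (\<psi> m) (Uhat F u0 t r Hs U m) * \<psi> m)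
      + Linf_norm (cell t m) (\<lambda>s. U s - Uhat F u0 t r Hs U m s)"
proof -
  interpret locally_Lipschitz_field F L T
    by standard (rule F_meas F_zero F_lip L_nonneg L_int L_cont2 L_cont3 L_mono2 L_mono3; assumption)+
  let ?W = "Uhat F u0 t r Hs U"
  define a b where "a = t (m - 1)" and "b = t m"
  have t_mono: "t i \<le> t j" if "i \<le> j" "j \<le> M" for i j
    using that
  proof (induction rule: dec_induct)
    case (step n)
    then show ?case
      using t_less[of n] by simp
  qed simp
  have less: "t (i - 1) < t i" if "i \<in> {1..M}" for i
    using t_less[of "i - 1"] that by auto
  have sub: "{t (i - 1)..t i} \<subseteq> {0..T}" if "i \<in> {1..M}" for i
    using t_mono[of 0 "i - 1"] t_mono[of i M] that t_first t_last by auto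
  have mM: "m \<in> {1..M}"
    using m by simp
  have ab: "a < b" "{a..b} \<subseteq> {0..T}"
    using less[OF mM] sub[OF mM] by (simp_all add: a_def b_def)
  note W_facts = Uhat_continuous[OF U_scheme _ less sub] Uhat_start[OF U_scheme _ less sub]
    Uhat_end[OF U_scheme _ less sub]
  have W_cont: "continuous_on {a..b} (?W m)"
    using Hs_fin_dim[OF mM] W_facts(1)[OF mM mM mM] unfolding a_def b_def by blast
  have W_a: "?W m a = orth_proj (Hs m) (left_value u0 t U (m - 1))"
    using Hs_fin_dim[OF mM] W_facts(2)[OF mM mM mM] unfolding a_def by blast
  have u_cont': "continuous_on {a..b} u"
    using u_cont ab(2) by (rule continuous_on_subset)

  have u_incr: "u s = u a + Bochner_integral (lebesgue_on {a..s}) (\<lambda>x. F x (u x))" if "s \<in> {a..b}" for s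
  proof -
    have s: "0 \<le> a" "a \<le> s" "{0..s} \<subseteq> {0..T}" "a \<in> {0..T}" "s \<in> {0..T}"
      using that ab by auto
    have "Bochner_integrable (lebesgue_on {0..s}) (\<lambda>x. F x (u x))"
      by (rule F_superposition_Bochner_integrable[OF s(3) continuous_on_subset[OF u_cont s(3)]])
    from Bochner_integral_split[OF s(1,2) this] show ?thesis
      using u_sol[OF s(4)] u_sol[OF s(5)] by simp
  qed

  have init: "ereal (norm (u a - ?W m a)) + eta_res F u0 t r Hs U m \<le> ereal (\<psi> m)"
  proof (cases "m = 1")
    case True
    \<comment> \<open>Taking \<open>s = a\<close> in \<open>u_incr\<close> cancels
      \<open>u a\<close> on both sides and leaves the vanishing integral over a single
      point.\<close>
    have "Bochner_integral (lebesgue_on {0..0}) (\<lambda>x. F x (u x)) = 0"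
      using u_incr[of a] ab(1) True t_first by (simp add: a_def)
    then have "u a = u0"
      using u_sol[of 0] \<open>T > 0\<close> True t_first by (simp add: a_def)
    then have "norm (u a - ?W m a) = eta_proj u0 t Hs U 0"
      using W_a True by (simp add: eta_proj_def left_value_def)
    with psi_first True show ?thesis
      by simp
  next
    case False
    then have m': "m \<in> {2..M}" "m - 1 \<in> {1..M}"
      using m by auto
    have "?W (m - 1) a = left_value u0 t U (m - 1)"
      using Hs_fin_dim[OF m'(2)] W_facts(3)[OF m'(2) m'(2) m'(2)] unfolding a_def by blast
    \<comment> \<open>The old reconstruction ends at the left value of \<open>U\<close> and the new
      one starts at its projection, so the jump between them is exactly
      \<open>eta_proj\<close>.\<close>
    then have "norm (u a - ?W m a) \<le> norm (u a - ?W (m - 1) a) + eta_proj u0 t Hs U (m - 1)"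
      using norm_triangle_ineq[of "u a - ?W (m - 1) a" "?W (m - 1) a - ?W m a"] m'
      by (simp add: W_a eta_proj_def)
    then have "ereal (norm (u a - ?W m a)) + eta_res F u0 t r Hs U m
        \<le> ereal (norm (u a - ?W (m - 1) a)) + ereal (eta_proj u0 t Hs U (m - 1)) + eta_res F u0 t r Hs U m"
      by (intro add_right_mono) simp
    also have "\<dots> \<le> ereal (\<psi> m)"
      using psi_later[OF m'(1)] by (simp add: a_def)
    finally show ?thesis .
  qed

  \<comment> \<open>The sum is formed in \<open>ereal\<close>, because \<open>eta_res\<close> has
    its values there; only the pointwise inequality returns to the reals.\<close>
  have AE_init: "AE s in lebesgue_on {a<..<b}.
      norm (u a - ?W m a) + norm (residual F u0 t r Hs U m s) \<le> \<psi> m"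
    using AE_norm_le_Linf_norm[where I="cell t m" and f="residual F u0 t r Hs U m"]
    unfolding cell_def a_def[symmetric] b_def[symmetric]
  proof eventually_elim
    case (elim s)
    then have "ereal (norm (u a - ?W m a)) + ereal (norm (residual F u0 t r Hs U m s))
        \<le> ereal (norm (u a - ?W m a)) + eta_res F u0 t r Hs U m"
      unfolding eta_res_def cell_def a_def[symmetric] b_def[symmetric] by (rule add_left_mono)
    then have "ereal (norm (u a - ?W m a)) + ereal (norm (residual F u0 t r Hs U m s)) \<le> ereal (\<psi> m)"
      using init by (rule order_trans)
    then show ?case
      by simp
  qed

  let ?g = "\<lambda>x. L x (norm (u x)) (norm (?W m x)) * norm (u x - ?W m x)"
  have g_int: "?g integrable_on {a..b}"
  proof -
    have "integrable (lebesgue_on {a..b}) (\<lambda>x. norm (u x - ?W m x) * L x (norm (u x)) (norm (?W m x)))"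
      by (intro integrable_lebesgue_on_continuous_mult L_superposition_integrable ab(2)
          continuous_intros u_cont' W_cont) auto
    then show ?thesis
      by (intro integrable_on_lebesgue_on) (simp_all add: mult.commute)
  qed
  have J_mono: "integral {a..x} ?g \<le> integral {a..y} ?g" if "a \<le> x" "x \<le> y" "y \<le> b" for x y
  proof (rule integral_subset_le)
    show "?g integrable_on {a..x}"
      by (rule integrable_on_subinterval[OF g_int]) (use that in simp)
    show "?g integrable_on {a..y}"
      by (rule integrable_on_subinterval[OF g_int]) (use that in simp)
    show "\<forall>s\<in>{a..y}. 0 \<le> ?g s"
      using that ab(2) by (intro ballI mult_nonneg_nonneg L_nonneg) auto
  qed (use that in auto)
  have error_ineq: "norm (u s - ?W m s) \<le> \<psi> m + integral {a..s} ?g" if s: "s \<in> {a..b}" for s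
  proof (cases "s = a")
    case True
    \<comment> \<open>At \<open>s = a\<close> there is no left neighbourhood. The inequality without
      the residual does not depend on the time, so it may be evaluated at \<open>b\<close>
      instead.\<close>
    have "AE s in lebesgue_on {a<..<b}. norm (u a - ?W m a) \<le> \<psi> m"
      using AE_init
    proof eventually_elim
      case (elim s)
      then show ?case
        using norm_ge_zero[of "residual F u0 t r Hs U m s"] by linarith
    qed
    then have "norm (u a - ?W m a) \<le> \<psi> m"
      by (rule AE_le_imp_le_left_continuous[where s=b]) (use ab in auto)
    with True show ?thesis
      by simp
  next
    case False
    have "AE s in lebesgue_on {a<..<b}. norm (u s - ?W m s) \<le> \<psi> m + integral {a..s} ?g"
      using AE_init AE_space
    proof eventually_elim
      case (elim s)
      then have "s \<in> {a..b}"
        by simp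
      from error_equation_bound[OF ab(2) this u_cont' W_cont u_incr[OF this]] elim(1)
      show ?case
        by (simp add: residual_def a_def)
    qed
    then show ?thesis
      by (rule AE_le_imp_le_left_continuous)
        (use s False J_mono in \<open>auto intro!: continuous_intros u_cont' W_cont\<close>)
  qed

  let ?D = "delta_set L (cell t m) (\<psi> m) (?W m)"
  have D: "?D \<noteq> {}"
    using delta_exists[of m] m by simp
  have D_bound: "norm (u s - ?W m s) \<le> \<delta> * \<psi> m" if "s \<in> {a..b}" "\<delta> \<in> ?D" for s \<delta>
  proof -
    have "\<delta> \<in> delta_set L {a<..<b} (\<psi> m) (?W m)"
      using that(2) by (simp add: cell_def a_def b_def)
    from error_le_delta_set[OF ab(2) u_cont' W_cont error_ineq this that(1)] show ?thesis .
  qed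
  let ?d = "delta L (cell t m) (\<psi> m) (?W m)"
  have bound: "norm (u s - ?W m s) \<le> ?d * \<psi> m" if s: "s \<in> {a..b}" for s
  proof (cases "\<psi> m = 0")
    case True
    with D D_bound[OF s] show ?thesis
      by auto
  next
    case False
    have "norm (u a - ?W m a) \<le> \<psi> m"
      using error_ineq[of a] ab(1) by simp
    with False have pos: "\<psi> m > 0"
      using norm_ge_zero[of "u a - ?W m a"] by linarith
    \<comment> \<open>Division by the positive \<open>\<psi> m\<close> turns the bounds into a lower
      bound of \<open>?D\<close>, hence of its infimum; for \<open>\<psi> m = 0\<close> any single
      member already gives the bound 0.\<close>
    have "norm (u s - ?W m s) / \<psi> m \<le> Inf ?D"
      using D D_bound[OF s] pos by (intro cInf_greatest) (auto simp: divide_le_eq)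
    with pos show ?thesis
      by (simp add: delta_def divide_le_eq)
  qed

  from scheme_piecewise_poly[OF U_scheme] mM obtain p
    where p: "p \<in> poly_space (r m) (Hs m)" "\<And>s. s \<in> cell t m \<Longrightarrow> U s = p s"
    unfolding piecewise_poly_def by blast
  show ?thesis
    unfolding Linf_norm_def[of _ "\<lambda>s. u s - U s"]
  proof (rule esssup_I)
    \<comment> \<open>The essential supremum is bounded only for measurable functions; on the cell
      \<open>U\<close> is replaced by its polynomial, which makes the error continuous
      there.\<close>
    have "continuous_on {a<..<b} (\<lambda>s. norm (u s - p s))"
      by (intro continuous_intros continuous_on_poly_space[OF p(1)] continuous_on_subset[OF u_cont']) auto
    then have "(\<lambda>s. norm (u s - p s)) \<in> borel_measurable (lebesgue_on (cell t m))"
      unfolding cell_def a_def[symmetric] b_def[symmetric]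
      by (rule continuous_imp_measurable_on_sets_lebesgue) simp
    then have "(\<lambda>s. norm (u s - U s)) \<in> borel_measurable (lebesgue_on (cell t m))"
      using p(2) by (subst measurable_cong[where g="\<lambda>s. norm (u s - p s)"]) auto
    then show "(\<lambda>s. ereal (norm (u s - U s))) \<in> borel_measurable (lebesgue_on (cell t m))"
      by (rule borel_measurable_ereal)
    show "AE s in lebesgue_on (cell t m). ereal (norm (u s - U s)) \<le>
        ereal (?d * \<psi> m) + Linf_norm (cell t m) (\<lambda>s. U s - ?W m s)"
      using AE_norm_le_Linf_norm[where I="cell t m" and f="\<lambda>s. U s - ?W m s"] AE_space
    proof eventually_elim
      case (elim s)
      then have "s \<in> {a..b}"
        by (auto simp: cell_def a_def b_def)
      have "norm (u s - U s) \<le> norm (u s - ?W m s) + norm (U s - ?W m s)"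
        by (metis dist_norm dist_triangle2)
      also have "\<dots> \<le> ?d * \<psi> m + norm (U s - ?W m s)"
        using bound[OF \<open>s \<in> {a..b}\<close>] by simp
      finally have "ereal (norm (u s - U s)) \<le> ereal (?d * \<psi> m) + ereal (norm (U s - ?W m s))"
        by simp
      also have "\<dots> \<le> ereal (?d * \<psi> m) + Linf_norm (cell t m) (\<lambda>s. U s - ?W m s)"
        using elim(1) by (rule add_left_mono)
      finally show ?case .
    qed
  qed
qed

end
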